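(* There is an absolute constant $C>0$ such that the following holds. Let $p$ be a prime, let $N$ be an integer with $1\le N<p$, and let $h$ be an integer with $h\not\equiv 0\pmod p$. Let $J_4$ denote the number of pairs of integers $(x,y)$ satisfying $$xy\equiv h\pmod p,\qquad 1\le x,y\le N.$$ Then $$\left|J_4-\frac{N^2}{p}\right|\le C\left(\frac{N}{p^{1/4}}+p^{1/2}\right).$$ *)

theory Defs
  imports Complex_Main "HOL-Number_Theory.Number_Theory"
begin

definition J4 :: "int \<Rightarrow> int \<Rightarrow> int \<Rightarrow> nat" where
  "J4 p N h =
     card {(x, y). 1 \<le> x \<and> x \<le> N \<and> 1 \<le> y \<and> y \<le> N \<and> [x * y = h] (mod p)}"

end

theory Submission
  imports Defs "HOL-Analysis.Convex" "Berlekamp_Zassenhaus.Finite_Field"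
    "HOL-Algebra.Algebraic_Closure_Type"
begin

hide_const (open) Divisibility.prime Polynomials.degree Polynomials.lead_coeff

text \<open>
  Detecting the congruence by additive characters, with the indicator of \<open>[1, N]\<close> bounded above and
  below by normalised convolutions of an interval with an interval of length \<open>M \<approx> p\<^bsup>3/4\<^esup>\<close>,
  expresses the count through Kloosterman sums. The convolution makes the Fourier coefficients
  absolutely summable with total \<open>O(sqrt (N / M))\<close> (Cauchy-Schwarz and Parseval), so no logarithms
  appear: the error is \<open>O(N M / p + sqrt p * N / M)\<close>.

  Weil's bound \<open>2 * sqrt p\<close> for Kloosterman sums is obtained as follows. If \<open>K n\<close> is the Kloosterman
  sum over the field with \<open>p ^ n\<close> elements, then \<open>K (2 * n) = 2 * p ^ n - (K n)\<^sup>2\<close>, so that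
  \<open>s n = \<bar>K n\<bar> / p\<^bsup>n/2\<^esup>\<close> satisfies \<open>s (2 * n) \<ge> (s n)\<^sup>2 - 2\<close> and is unbounded along powers of 2
  as soon as \<open>s 1 > 2\<close>. On the other hand Stepanov's method bounds every fibre of
  \<open>x \<mapsto> Tr (x + k / x)\<close> over the field with \<open>p ^ (2 * m)\<close> elements by
  \<open>p ^ (2 * m - 1) + 5 * p ^ m\<close>, which makes \<open>s (2 * m)\<close> bounded.
\<close>

section \<open>Kloosterman sums\<close>

text \<open>Over an algebraically closed field \<open>P\<close> splits, and by the product rule a
  repeated root would also be a root of the derivative. So the multiset of roots is a set, of size
  the degree.\<close>

lemma card_roots_separable:
  fixes P :: "'a::alg_closed_field poly"
  assumes nz: "P \<noteq> 0" and sep: "\<And>x. poly P x = 0 \<Longrightarrow> poly (pderiv P) x \<noteq> 0"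
  shows "card {x. poly P x = 0} = degree P"
proof -
  obtain A where A: "size A = degree P" "P = smult (lead_coeff P) (\<Prod>x\<in>#A. [:-x, 1:])"
    using alg_closed_imp_factorization[OF nz] by blast
  have lc: "lead_coeff P \<noteq> 0" using nz by simp
  have root_iff: "poly (smult (lead_coeff P) (\<Prod>x\<in>#B. [:-x, 1:])) y = 0 \<longleftrightarrow> y \<in># B" for B y
    using lc by (simp add: poly_prod_mset prod_mset_zero_iff image_iff)
  have setA: "set_mset A = {x. poly P x = 0}"
    using root_iff[of A] A(2) by auto
  have "count A x = 1" if x: "x \<in># A" for x
  proof -
    obtain B where B: "A = add_mset x B" using x by (meson multi_member_split)
    define R where "R = smult (lead_coeff P) (\<Prod>x\<in>#B. [:-x, 1:])"
    have P: "P = [:-x, 1:] * R" using A(2) unfolding R_def B by simp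
    have "poly P x = 0" using x setA by auto
    hence "poly (pderiv P) x \<noteq> 0" by (rule sep)
    moreover have "poly (pderiv P) x = poly R x" by (subst P, subst pderiv_mult) (simp add: pderiv_pCons)
    ultimately have "x \<notin># B" using root_iff[of B x] by (simp add: R_def)
    thus ?thesis by (simp add: B not_in_iff)
  qed
  hence "size A = (\<Sum>x\<in>set_mset A. 1)" by (simp add: size_multiset_overloaded_eq)
  thus ?thesis using A(1) setA by simp
qed

text \<open>Gaussian elimination by induction on the number of equations: the last one is solved for
  an unknown \<open>j\<close> with nonzero coefficient, which is substituted into the others. This
  supplies the coefficients in Stepanov's method.\<close>

lemma exists_linear_relation:
  fixes f :: "'i \<Rightarrow> nat \<Rightarrow> 'a::field"
  assumes "finite I" "D < card I"
  shows "\<exists>d. (\<exists>i\<in>I. d i \<noteq> 0) \<and> (\<forall>n<D. (\<Sum>i\<in>I. d i * f i n) = 0)"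
  using assms
proof (induction D arbitrary: I f)
  case 0
  then obtain i where "i \<in> I" by fastforce
  thus ?case by (intro exI[of _ "\<lambda>_. 1"]) auto
next
  case (Suc D)
  show ?case
  proof (cases "\<forall>i\<in>I. f i D = 0")
    case True
    from Suc.IH[of I f] Suc.prems obtain d where
      "\<exists>i\<in>I. d i \<noteq> 0" "\<forall>n<D. (\<Sum>i\<in>I. d i * f i n) = 0" by auto
    with True show ?thesis by (intro exI[of _ d]) (auto simp: less_Suc_eq)
  next
    case False
    then obtain j where j: "j \<in> I" "f j D \<noteq> 0" by blast
    define J where "J = I - {j}"
    have J: "finite J" "D < card J" "j \<notin> J" "I = insert j J"
      using Suc.prems j by (auto simp: J_def)
    obtain d where d: "\<exists>i\<in>J. d i \<noteq> 0"
      "\<And>n. n < D \<Longrightarrow> (\<Sum>i\<in>J. d i * (f i n - f i D / f j D * f j n)) = 0"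
      using Suc.IH[of J "\<lambda>i n. f i n - f i D / f j D * f j n"] J by auto
    define d' where "d' = d(j := - (\<Sum>i\<in>J. d i * (f i D / f j D)))"
    have eq: "(\<Sum>i\<in>I. d' i * f i n) = (\<Sum>i\<in>J. d i * (f i n - f i D / f j D * f j n))" for n
    proof -
      have "(\<Sum>i\<in>I. d' i * f i n) = d' j * f j n + (\<Sum>i\<in>J. d' i * f i n)"
        using J by simp
      also have "(\<Sum>i\<in>J. d' i * f i n) = (\<Sum>i\<in>J. d i * f i n)"
        using J by (intro sum.cong) (auto simp: d'_def)
      also have "d' j = - (\<Sum>i\<in>J. d i * (f i D / f j D))" by (simp add: d'_def)
      finally show ?thesis
        by (simp add: sum_subtractf sum_distrib_right right_diff_distrib mult.assoc)
    qed
    show ?thesis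
    proof (intro exI[of _ d'] conjI allI impI)
      show "\<exists>i\<in>I. d' i \<noteq> 0" using d(1) J by (auto simp: d'_def)
      fix n assume "n < Suc D"
      then consider "n < D" | "n = D" by linarith
      thus "(\<Sum>i\<in>I. d' i * f i n) = 0"
        unfolding eq using d(2) j by cases (auto intro!: sum.neutral)
    qed
  qed
qed

text \<open>Among the terms with nonzero coefficient, the one of largest degree has nothing to
  cancel against.\<close>

lemma sum_smult_distinct_degrees_nonzero:
  fixes f :: "'i \<Rightarrow> 'a::field poly"
  assumes fin: "finite I" and inj: "inj_on (\<lambda>i. degree (f i)) I"
    and nz: "\<And>i. i \<in> I \<Longrightarrow> f i \<noteq> 0" and c: "\<exists>i\<in>I. c i \<noteq> 0"
  shows "(\<Sum>i\<in>I. smult (c i) (f i)) \<noteq> 0"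
proof -
  define J where "J = {i\<in>I. c i \<noteq> 0}"
  have "finite J" "J \<noteq> {}" using fin c by (auto simp: J_def)
  have "Max ((\<lambda>i. degree (f i)) ` J) \<in> (\<lambda>i. degree (f i)) ` J"
    using \<open>finite J\<close> \<open>J \<noteq> {}\<close> by (intro Max_in) auto
  then obtain j where j: "j \<in> J" "Max ((\<lambda>i. degree (f i)) ` J) = degree (f j)" by auto
  have j_max: "degree (f i) \<le> degree (f j)" if "i \<in> J" for i
    unfolding j(2)[symmetric] using \<open>finite J\<close> that by (intro Max_ge) auto
  have jI: "j \<in> I" "c j \<noteq> 0" using j(1) by (auto simp: J_def)
  have zero: "c i * coeff (f i) (degree (f j)) = 0" if "i \<in> I" "i \<noteq> j" for i
  proof (cases "c i = 0")
    case False
    hence "degree (f i) \<le> degree (f j)" using that j_max by (auto simp: J_def)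
    moreover have "degree (f i) \<noteq> degree (f j)" using inj that jI by (auto simp: inj_on_def)
    ultimately show ?thesis by (simp add: coeff_eq_0)
  qed auto
  have "coeff (\<Sum>i\<in>I. smult (c i) (f i)) (degree (f j)) = (\<Sum>i\<in>I. c i * coeff (f i) (degree (f j)))"
    by (simp add: coeff_sum)
  also have "\<dots> = c j * lead_coeff (f j)"
    using fin jI(1) zero by (subst sum.remove[of I j]) (simp_all add: sum.neutral del: mult_eq_0_iff)
  also have "\<dots> \<noteq> 0" using jI nz[OF jI(1)] by simp
  finally show ?thesis by (metis coeff_0)
qed

section \<open>Additive characters modulo p\<close>

definition echar :: "nat \<Rightarrow> int \<Rightarrow> complex" where
  "echar p m = cis (2 * pi * of_int m / of_nat p)"

lemma echar_0 [simp]: "echar p 0 = 1" by (simp add: echar_def)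

lemma echar_add: "echar p (m + n) = echar p m * echar p n"
  by (simp add: echar_def cis_mult add_divide_distrib ring_distribs)

lemma norm_echar [simp]: "norm (echar p m) = 1" by (simp add: echar_def)

lemma echar_uminus: "echar p (- m) = cnj (echar p m)"
  by (simp add: echar_def cis_cnj)

lemma echar_eq_1_iff:
  assumes "p > 0"
  shows "echar p m = 1 \<longleftrightarrow> int p dvd m"
proof -
  have "echar p m = 1 \<longleftrightarrow> cos (2 * pi * of_int m / of_nat p) = 1"
    by (auto simp: echar_def complex_eq_iff cos_one_sin_zero)
  also have "\<dots> \<longleftrightarrow> (\<exists>k::int. 2 * pi * of_int m / of_nat p = of_int k * 2 * pi)"
    by (simp add: cos_one_2pi_int)
  also have "\<dots> \<longleftrightarrow> (\<exists>k::int. real_of_int m = real_of_int (k * int p))"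
    using assms by (intro ex_cong1) (auto simp: field_simps)
  also have "\<dots> \<longleftrightarrow> int p dvd m"
    by (simp only: of_int_eq_iff) (auto simp: dvd_def mult.commute)
  finally show ?thesis .
qed

lemma echar_cong:
  assumes "p > 0" "[m = n] (mod int p)"
  shows "echar p m = echar p n"
proof -
  have "echar p m = echar p (m - n) * echar p n" by (simp flip: echar_add)
  also have "echar p (m - n) = 1"
    using assms by (simp add: echar_eq_1_iff cong_iff_dvd_diff)
  finally show ?thesis by simp
qed

lemma echar_mult_power: "echar p (m * int k) = echar p m ^ k"
  by (induction k) (simp_all add: ring_distribs echar_add)

lemma sum_echar:
  assumes "p > 0"
  shows "(\<Sum>a\<in>{0..<int p}. echar p (a * n)) = (if int p dvd n then of_nat p else 0)"
proof -
  have "(\<Sum>a\<in>{0..<int p}. echar p (a * n)) = (\<Sum>k<p. echar p n ^ k)"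
    by (rule sum.reindex_bij_witness[of _ int nat]) (auto simp: mult.commute simp flip: echar_mult_power)
  also have "\<dots> = (if int p dvd n then of_nat p else 0)"
  proof (cases "int p dvd n")
    case True
    hence "echar p n = 1" using assms by (simp add: echar_eq_1_iff)
    thus ?thesis using True by simp
  next
    case False
    hence "echar p n \<noteq> 1" using assms by (simp add: echar_eq_1_iff)
    moreover have "echar p n ^ p = 1" using assms by (simp add: echar_eq_1_iff flip: echar_mult_power)
    ultimately show ?thesis using False by (simp add: geometric_sum)
  qed
  finally show ?thesis .
qed

section \<open>Finite fields, traces and Kloosterman sums\<close>

text \<open>Pitfall: \<open>gf 0\<close> is the whole field; in an algebraically closed field \<open>gf n\<close> is finite only for \<open>n > 0\<close>.\<close>
definition gf :: "nat \<Rightarrow> 'a::field_prime_char set" where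
  "gf n = {x. x ^ (CHAR('a) ^ n) = x}"

text \<open>On \<open>gf n\<close> this is the absolute trace to the prime field. As a polynomial it
  makes sense outside \<open>gf n\<close> too: Stepanov's argument evaluates \<open>tr m\<close> at
  elements of \<open>gf (2 * m)\<close>.\<close>

definition tr :: "nat \<Rightarrow> 'a::field_prime_char \<Rightarrow> 'a" where
  "tr n x = (\<Sum>i<n. x ^ (CHAR('a) ^ i))"

text \<open>The choice is well defined only on the prime field \<open>gf 1\<close>.\<close>
definition addchar :: "'a::field_prime_char \<Rightarrow> complex" where
  "addchar x = echar (CHAR('a)) (SOME m. of_int m = x)"

definition kloosterman :: "nat \<Rightarrow> 'a::field_prime_char \<Rightarrow> complex" where
  "kloosterman n k = (\<Sum>x\<in>gf n - {0}. addchar (tr n (x + k / x)))"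

definition hyperbola :: "nat \<Rightarrow> int \<Rightarrow> (int \<times> int) set" where
  "hyperbola p h = {(z, w). z \<in> {0..<int p} \<and> w \<in> {0..<int p} \<and> [z * w = h] (mod int p)}"

lemma finite_hyperbola [simp]: "finite (hyperbola p h)"
  by (rule finite_subset[of _ "{0..<int p} \<times> {0..<int p}"]) (auto simp: hyperbola_def)

text \<open>With \<open>w\<close> standing for \<open>h / z\<close>, the sum is the Kloosterman sum
  with parameters \<open>a\<close> and \<open>b * h\<close>. Only integers occur, no field type, so
  the bound can be proved inside some field of characteristic \<open>p\<close> and then used for
  counting.\<close>

definition kloosterman_bound :: "nat \<Rightarrow> bool" where
  "kloosterman_bound p \<longleftrightarrow> (\<forall>h. \<not> int p dvd h \<longrightarrow>
     card (hyperbola p h) = p - 1 \<and>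
     (\<forall>a b. \<not> (int p dvd a \<and> int p dvd b) \<longrightarrow>
        norm (\<Sum>(z, w)\<in>hyperbola p h. echar p (a * z + b * w)) \<le> 2 * sqrt p))"

text \<open>If \<open>s 0 = 2 + \<delta>\<close> with \<open>\<delta> > 0\<close>, the recursion
  pushes \<open>s j\<close> above \<open>2 + (j + 1) * \<delta>\<close>. This linear growth, far
  weaker than the true one, already contradicts boundedness.\<close>

lemma chebyshev_growth:
  fixes s :: "nat \<Rightarrow> real"
  assumes step: "\<And>j. s (Suc j) \<ge> (s j)\<^sup>2 - 2" and bound: "\<And>j. s (Suc j) \<le> B"
  shows "s 0 \<le> 2"
proof (rule ccontr)
  assume "\<not> s 0 \<le> 2"
  define \<delta> where "\<delta> = s 0 - 2"
  have \<delta>: "\<delta> > 0" using \<open>\<not> s 0 \<le> 2\<close> by (simp add: \<delta>_def)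
  have grow: "s j \<ge> 2 + (real j + 1) * \<delta>" for j
  proof (induction j)
    case (Suc j)
    define u where "u = (real j + 1) * \<delta>"
    have u: "u \<ge> \<delta>" using \<delta> by (simp add: u_def algebra_simps)
    have "(2 + u)\<^sup>2 \<le> (s j)\<^sup>2" using Suc u \<delta> by (intro power_mono) (auto simp: u_def)
    hence "s (Suc j) \<ge> 2 + 4 * u + u\<^sup>2" using step[of j] by (simp add: power2_eq_square algebra_simps)
    hence "s (Suc j) \<ge> 2 + u + \<delta>" using u \<delta> zero_le_power2[of u] by linarith
    thus ?case by (simp add: u_def algebra_simps)
  qed (simp add: \<delta>_def)
  obtain n :: nat where "B / \<delta> < real n" using reals_Archimedean2 by blast
  hence "B < real n * \<delta>" using \<delta> by (simp add: pos_divide_less_eq)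
  moreover have "real n * \<delta> \<le> (real (Suc n) + 1) * \<delta>" using \<delta> by (intro mult_right_mono) auto
  ultimately show False using grow[of "Suc n"] bound[of n] by linarith
qed

section \<open>Finite subfields of an algebraically closed field\<close>

context
  fixes p :: nat
  assumes p_def: "p = CHAR('a::{alg_closed_field,field_prime_char})"
begin

lemma p_prime: "prime p" unfolding p_def by simp

lemma p_gt_1: "p > 1" using p_prime prime_gt_1_nat by blast

lemma frob_add: "(x + y :: 'a) ^ (p ^ n) = x ^ (p ^ n) + y ^ (p ^ n)"
  by (rule freshmans_dream') (auto simp: p_def)

lemma frob_sum: "(sum f A :: 'a) ^ (p ^ n) = (\<Sum>i\<in>A. f i ^ (p ^ n))"
  by (rule freshmans_dream_sum') (auto simp: p_def)

lemma frob_uminus: "(- x :: 'a) ^ (p ^ n) = - (x ^ (p ^ n))"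
proof -
  have "(-x) ^ (p ^ n) + x ^ (p ^ n) = (-x + x) ^ (p ^ n)" by (simp only: frob_add)
  also have "\<dots> = 0" using p_gt_1 by simp
  finally show ?thesis by (simp add: eq_neg_iff_add_eq_0)
qed

lemma frob_frob: "((x :: 'a) ^ (p ^ n)) ^ (p ^ m) = x ^ (p ^ (n + m))"
  by (simp add: power_add flip: power_mult)

lemma gf_iff: "(x :: 'a) \<in> gf n \<longleftrightarrow> x ^ (p ^ n) = x" by (simp add: gf_def p_def)

lemma gf_0 [simp]: "(0 :: 'a) \<in> gf n" using p_gt_1 by (simp add: gf_iff)
lemma gf_1 [simp]: "(1 :: 'a) \<in> gf n" by (simp add: gf_iff)
lemma gf_add: "x \<in> gf n \<Longrightarrow> y \<in> gf n \<Longrightarrow> (x + y :: 'a) \<in> gf n" by (simp add: gf_iff frob_add)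
lemma gf_uminus: "x \<in> gf n \<Longrightarrow> (- x :: 'a) \<in> gf n" by (simp add: gf_iff frob_uminus)
lemma gf_diff: "x \<in> gf n \<Longrightarrow> y \<in> gf n \<Longrightarrow> (x - y :: 'a) \<in> gf n"
  using gf_add[of x n "-y"] gf_uminus by simp
lemma gf_mult: "x \<in> gf n \<Longrightarrow> y \<in> gf n \<Longrightarrow> (x * y :: 'a) \<in> gf n" by (simp add: gf_iff power_mult_distrib)
lemma gf_divide: "x \<in> gf n \<Longrightarrow> y \<in> gf n \<Longrightarrow> (x / y :: 'a) \<in> gf n" by (simp add: gf_iff power_divide)

lemma gf_power_mult: "(x :: 'a) \<in> gf n \<Longrightarrow> x ^ (p ^ (n * j)) = x"
  by (induction j) (simp_all add: gf_iff flip: frob_frob)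

lemma gf_mono_mult: "(x :: 'a) \<in> gf n \<Longrightarrow> x \<in> gf (n * j)"
  using gf_power_mult by (simp add: gf_iff)

lemma gf_1_subset: "(x :: 'a) \<in> gf 1 \<Longrightarrow> x \<in> gf n"
  using gf_mono_mult[of x 1 n] by simp

lemma gf_1_frob: "(x :: 'a) \<in> gf 1 \<Longrightarrow> x ^ (p ^ n) = x"
  using gf_1_subset[of x n] by (simp add: gf_iff)

lemma tr_eq: "tr n (x :: 'a) = (\<Sum>i<n. x ^ (p ^ i))" by (simp add: tr_def p_def)

lemma tr_1: "tr 1 (x :: 'a) = x" by (simp add: tr_eq)

lemma tr_add: "tr n (x + y :: 'a) = tr n x + tr n y"
  by (simp add: tr_eq frob_add sum.distrib)

lemma tr_scalar: "c \<in> gf 1 \<Longrightarrow> tr n (c * x :: 'a) = c * tr n x"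
  by (simp add: tr_eq power_mult_distrib gf_1_frob sum_distrib_left)

text \<open>The Frobenius map shifts the terms of the trace cyclically, since
  \<open>x ^ (p ^ n) = x\<close>.\<close>

lemma tr_in_gf_1: assumes "(x :: 'a) \<in> gf n" shows "tr n x \<in> gf 1"
proof (cases n)
  case 0 thus ?thesis by (simp add: tr_eq)
next
  case (Suc m)
  have "tr n x ^ (p ^ 1) = (\<Sum>i<n. x ^ (p ^ (Suc i)))"
    unfolding tr_eq frob_sum frob_frob by simp
  also have "\<dots> = tr n x - x ^ (p ^ 0) + x ^ (p ^ n)"
    unfolding tr_eq Suc by (subst (2) sum.lessThan_Suc_shift) simp
  also have "\<dots> = tr n x" using assms by (simp add: gf_iff)
  finally show ?thesis by (simp only: gf_iff)
qed

text \<open>Transitivity of the trace: for \<open>x\<close> in \<open>gf (2 * n)\<close> the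
  argument on the right is the relative trace down to \<open>gf n\<close>. The identity itself holds
  for every \<open>x\<close>.\<close>

lemma tr_double: "tr (2 * n) (x :: 'a) = tr n (x + x ^ (p ^ n))"
proof -
  have "tr (2 * n) x = (\<Sum>i<n. x ^ (p ^ i)) + (\<Sum>i\<in>{n..<2*n}. x ^ (p ^ i))"
    unfolding tr_eq by (subst sum.union_disjoint[symmetric]) (auto intro: sum.cong)
  also have "(\<Sum>i\<in>{n..<2*n}. x ^ (p ^ i)) = (\<Sum>i<n. x ^ (p ^ (n + i)))"
    by (rule sum.reindex_bij_witness[of _ "\<lambda>i. n + i" "\<lambda>i. i - n"]) auto
  finally show ?thesis by (simp add: tr_add) (simp add: tr_eq frob_frob)
qed

lemma of_int_in_gf_1: "(of_int m :: 'a) \<in> gf 1"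
proof -
  have nat: "(of_nat k :: 'a) \<in> gf 1" for k by (induction k) (auto intro: gf_add)
  show ?thesis using gf_uminus[OF nat] nat by (cases m rule: int_cases2) simp_all
qed


text \<open>\<open>gf n\<close> is the root set of \<open>X ^ (p ^ n) - X\<close>. For
  \<open>n > 0\<close> its derivative is the constant -1, so the polynomial is separable.\<close>

lemma card_gf:
  assumes "n > 0"
  shows "card (gf n :: 'a set) = p ^ n" "finite (gf n :: 'a set)"
proof -
  define P :: "'a poly" where "P = monom 1 (p ^ n) - monom 1 1"
  have q: "p ^ n > 1" using p_gt_1 assms by (rule one_less_power)
  have "coeff P (p ^ n) = 1" using q by (simp add: P_def)
  hence nz: "P \<noteq> 0" by (metis coeff_0 zero_neq_one)
  have deg: "degree P = p ^ n"
  proof (rule antisym)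
    show "degree P \<le> p ^ n" unfolding P_def using q
      by (intro degree_diff_le) (auto simp: degree_monom_eq)
    show "p ^ n \<le> degree P" using \<open>coeff P (p ^ n) = 1\<close> by (intro le_degree) auto
  qed
  have roots: "{x. poly P x = 0} = gf n" by (auto simp: P_def gf_iff poly_monom)
  have "(of_nat (p ^ n) :: 'a) = 0" using assms by (simp add: p_def)
  hence "poly (pderiv P) x = -1" for x
    by (simp add: P_def pderiv_diff pderiv_monom poly_monom)
  hence "card {x. poly P x = 0} = degree P" using nz by (intro card_roots_separable) auto
  thus "card (gf n :: 'a set) = p ^ n" by (simp add: roots deg)
  show "finite (gf n :: 'a set)" using poly_roots_finite[OF nz] by (simp add: roots)
qed

lemma of_int_eq_iff_cong: "(of_int a :: 'a) = of_int b \<longleftrightarrow> [a = b] (mod int p)"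
  by (simp add: of_int_eq_iff_cong_CHAR p_def)

lemma inj_of_int: "inj_on (of_int :: int \<Rightarrow> 'a) {0..<int p}"
  by (auto simp: inj_on_def of_int_eq_iff_cong cong_def)

lemma of_int_image: "(of_int :: int \<Rightarrow> 'a) ` {0..<int p} = gf 1"
proof (rule card_subset_eq)
  show "finite (gf 1 :: 'a set)" using card_gf by simp
  show "(of_int :: int \<Rightarrow> 'a) ` {0..<int p} \<subseteq> gf 1" using of_int_in_gf_1 by blast
  show "card ((of_int :: int \<Rightarrow> 'a) ` {0..<int p}) = card (gf 1 :: 'a set)"
    using inj_of_int card_gf(1)[of 1] by (simp add: card_image)
qed

lemma gf_1_cases: assumes "(x :: 'a) \<in> gf 1" obtains m where "x = of_int m"
  using assms unfolding of_int_image[symmetric] by auto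

section \<open>Orthogonality of additive characters\<close>

lemma addchar_of_int: "addchar (of_int m :: 'a) = echar p m"
proof -
  have "(of_int (SOME k. (of_int k :: 'a) = of_int m) :: 'a) = of_int m"
    by (rule someI) (rule refl)
  hence "[(SOME k. (of_int k :: 'a) = of_int m) = m] (mod int p)"
    unfolding of_int_eq_iff_cong .
  thus ?thesis unfolding addchar_def p_def[symmetric] using p_gt_1 by (intro echar_cong) auto
qed

lemma addchar_add:
  assumes "(x :: 'a) \<in> gf 1" "y \<in> gf 1"
  shows "addchar (x + y) = addchar x * addchar y"
proof -
  obtain a b where "x = of_int a" "y = of_int b" using assms by (metis gf_1_cases)
  thus ?thesis by (simp add: addchar_of_int echar_add flip: of_int_add)
qed

lemma norm_addchar: "norm (addchar (x :: 'a)) = 1" by (simp add: addchar_def)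

lemma addchar_0: "addchar (0 :: 'a) = 1" using addchar_of_int[of 0] by simp

lemma addchar_1: "addchar (1 :: 'a) \<noteq> 1"
  using addchar_of_int[of 1] p_gt_1 by (simp add: echar_eq_1_iff)

text \<open>The trace is a nonzero polynomial of degree at most \<open>p ^ (n - 1)\<close>, too
  small to vanish on all \<open>p ^ n\<close> elements. Linearity over the prime field then rescales
  a nonzero value to 1.\<close>

lemma tr_surj:
  assumes n: "n > 0"
  obtains y where "(y :: 'a) \<in> gf n" "tr n y = 1"
proof -
  define T :: "'a poly" where "T = (\<Sum>i<n. monom 1 (p ^ i))"
  have "coeff T (p ^ 0) = (\<Sum>i<n. if i = 0 then 1 else 0)"
    unfolding T_def coeff_sum using p_gt_1 by (intro sum.cong) auto
  also have "\<dots> = 1" using n by simp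
  finally have "T \<noteq> 0" by (metis coeff_0 zero_neq_one)
  have "degree T \<le> p ^ (n - 1)" unfolding T_def
    using p_gt_1 n by (intro degree_sum_le) (auto simp: degree_monom_eq intro!: power_increasing)
  also have "\<dots> < p ^ n" using p_gt_1 n by (intro power_strict_increasing) auto
  finally have "card {x. poly T x = 0} < card (gf n :: 'a set)"
    using card_poly_roots_bound[OF \<open>T \<noteq> 0\<close>] card_gf(1)[OF n] by simp
  hence "\<not> gf n \<subseteq> {x. poly T x = 0}"
    using card_mono[OF poly_roots_finite[OF \<open>T \<noteq> 0\<close>]] by (metis not_less)
  then obtain z where z: "z \<in> gf n" "poly T z \<noteq> 0" by blast
  have "poly T z = tr n z" by (simp add: T_def poly_sum poly_monom tr_eq)
  with z have t: "tr n z \<noteq> 0" by simp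
  have inv: "1 / tr n z \<in> gf 1" using tr_in_gf_1[OF z(1)] by (intro gf_divide) auto
  have "tr n (1 / tr n z * z) = 1" using tr_scalar[OF inv, of n z] t by simp
  moreover have "1 / tr n z * z \<in> gf n" using gf_1_subset[OF inv] z by (intro gf_mult)
  ultimately show ?thesis by (rule that[rotated])
qed

text \<open>For \<open>u \<noteq> 0\<close>, translating \<open>t\<close> by some \<open>t0\<close>
  with \<open>tr n (t0 * u) = 1\<close> multiplies the sum by \<open>addchar 1 \<noteq> 1\<close>,
  so the sum vanishes.\<close>

lemma sum_addchar_tr:
  assumes n: "n > 0" and u: "(u :: 'a) \<in> gf n"
  shows "(\<Sum>t\<in>gf n. addchar (tr n (t * u))) = (if u = 0 then of_nat (p ^ n) else 0)"
proof (cases "u = 0")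
  case True
  moreover have "tr n (0 :: 'a) = 0" using p_gt_1 by (simp add: tr_eq power_0_left)
  ultimately show ?thesis using card_gf(1)[OF n] by (simp add: addchar_0)
next
  case False
  define S where "S = (\<Sum>t\<in>gf n. addchar (tr n (t * u)))"
  obtain y where y: "(y :: 'a) \<in> gf n" "tr n y = 1" using tr_surj[OF n] .
  define t0 where "t0 = y / u"
  have t0: "t0 \<in> gf n" "tr n (t0 * u) = 1"
    using y u False by (auto simp: t0_def intro: gf_divide)
  have "S = (\<Sum>t\<in>gf n. addchar (tr n ((t + t0) * u)))"
    unfolding S_def
    by (rule sum.reindex_bij_witness[of _ "\<lambda>t. t + t0" "\<lambda>t. t - t0"]) (auto intro: gf_add gf_diff t0)
  also have "\<dots> = (\<Sum>t\<in>gf n. addchar (tr n (t * u)) * addchar (1 :: 'a))"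
    by (intro sum.cong refl)
       (simp only: distrib_right tr_add t0 addchar_add[OF tr_in_gf_1[OF gf_mult[OF _ u]] gf_1])
  also have "\<dots> = S * addchar (1 :: 'a)" by (simp add: S_def sum_distrib_right)
  finally have "S * (1 - addchar (1 :: 'a)) = 0" by (simp add: algebra_simps)
  with addchar_1 have "S = 0" by simp
  thus ?thesis using False by (simp add: S_def)
qed

section \<open>Doubling the degree of a Kloosterman sum\<close>

text \<open>
  Both sides are sums over pairs \<open>(t, N)\<close>, the trace and norm of \<open>z\<close> in the quadratic extension on
  the left and \<open>(x + y, x * y)\<close> on the right. For each polynomial \<open>X\<^sup>2 - t X + N\<close> the number of
  \<open>z\<close> and the number of pairs \<open>(x, y)\<close> add up to 2, because its roots are either conjugate or
  rational.
\<close>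
lemma kloosterman_double:
  assumes n: "n > 0" and k: "(k :: 'a) \<in> gf 1" "k \<noteq> 0"
  shows "kloosterman (2 * n) k = 2 * of_nat (p ^ n) - (kloosterman n k)\<^sup>2"
proof -
  define q where "q = p ^ n"
  define F where "F = (gf n :: 'a set)"
  define E where "E = (gf (2 * n) :: 'a set)"
  \<comment> \<open>A sum \<open>x + k / x + (y + k / y)\<close> depends only on
    \<open>t = x + y\<close> and \<open>N = x * y\<close>; it equals \<open>t + k * t / N\<close>.
    This applies to conjugates and to rational pairs alike.\<close>
  define \<phi> where "\<phi> = (\<lambda>(t :: 'a, N). addchar (tr n (t + k * t / N)))"
  have finF: "finite F" and finE: "finite E" using card_gf n by (auto simp: F_def E_def)
  have F_iff: "x \<in> F \<longleftrightarrow> x ^ q = x" for x by (simp add: F_def gf_iff q_def)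
  have E_iff: "x \<in> E \<longleftrightarrow> (x ^ q) ^ q = x" for x
    by (simp add: E_def gf_iff q_def frob_frob mult_2)
  have kq: "k ^ q = k" and kF: "k \<in> F" using k gf_1_frob gf_1_subset by (auto simp: q_def F_def)
  have q_add: "(x + y) ^ q = x ^ q + y ^ q" for x y :: 'a by (simp add: q_def frob_add)
  define A where "A = E - {0}"
  define B where "B = (F - {0}) \<times> (F - {0})"
  define g where "g = (\<lambda>z :: 'a. (z + z ^ q, z * z ^ q))"
  define h where "h = (\<lambda>(x :: 'a, y). (x + y, x * y))"
  define T where "T = F \<times> (F - {0})"
  have fin: "finite A" "finite B" "finite T" using finF finE by (auto simp: A_def B_def T_def)
  have gA: "g ` A \<subseteq> T"
    by (auto simp: g_def A_def T_def F_iff E_iff q_add power_mult_distrib add.commute mult.commute)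
  have hB: "h ` B \<subseteq> T"
    by (auto simp: h_def B_def T_def F_iff q_add power_mult_distrib)
  have "kloosterman (2 * n) k = (\<Sum>z\<in>A. \<phi> (g z))"
    unfolding kloosterman_def A_def E_def[symmetric]
  proof (intro sum.cong refl)
    fix z assume z: "z \<in> E - {0}"
    have eq: "z + k / z + (z + k / z) ^ q = (z + z ^ q) + k * (z + z ^ q) / (z * z ^ q)"
      using z by (simp add: q_add power_divide kq field_simps)
    show "addchar (tr (2 * n) (z + k / z)) = \<phi> (g z)"
      unfolding tr_double \<phi>_def g_def q_def[symmetric] prod.case eq ..
  qed
  hence 1: "kloosterman (2 * n) k = (\<Sum>w\<in>T. of_nat (card {z\<in>A. g z = w}) * \<phi> w)"
    using sum.group[OF fin(1) fin(3) gA, of "\<lambda>z. \<phi> (g z)"] by simp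
  have "(kloosterman n k)\<^sup>2 = (\<Sum>x\<in>F-{0}. \<Sum>y\<in>F-{0}. addchar (tr n (x + k / x)) * addchar (tr n (y + k / y)))"
    by (simp add: kloosterman_def power2_eq_square sum_product F_def)
  also have "\<dots> = (\<Sum>w\<in>B. \<phi> (h w))"
    unfolding sum.cartesian_product B_def
  proof (intro sum.cong refl)
    fix w assume "w \<in> (F - {0}) \<times> (F - {0})"
    then obtain x y where w: "w = (x, y)" and xy: "x \<in> F" "x \<noteq> 0" "y \<in> F" "y \<noteq> 0" by blast
    have "addchar (tr n (x + k / x)) * addchar (tr n (y + k / y)) =
          addchar (tr n ((x + k / x) + (y + k / y)))"
      using xy kF unfolding F_def tr_add[of n "x + k / x"]
      by (intro addchar_add[symmetric] tr_in_gf_1 gf_add gf_divide)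
    also have "(x + k / x) + (y + k / y) = (x + y) + k * (x + y) / (x * y)"
      using xy by (simp add: field_simps)
    finally show "(case w of (x, y) \<Rightarrow> addchar (tr n (x + k / x)) * addchar (tr n (y + k / y))) = \<phi> (h w)"
      by (simp add: \<phi>_def h_def w)
  qed
  finally have 2: "(kloosterman n k)\<^sup>2 = (\<Sum>w\<in>T. of_nat (card {z\<in>B. h z = w}) * \<phi> w)"
    using sum.group[OF fin(2) fin(3) hB, of "\<lambda>z. \<phi> (h z)"] by simp
  have card2: "card {z\<in>A. g z = w} + card {z\<in>B. h z = w} = 2" if "w \<in> T" for w
  proof -
    obtain t N where w: "w = (t, N)" by (cases w)
    with that have tN: "t \<in> F" "N \<in> F" "N \<noteq> 0" by (auto simp: T_def)
    have "\<exists>r. poly [:N, -t, 1:] r = 0" by (rule alg_closed_imp_poly_has_root) simp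
    then obtain r where r: "N - r * t + r * r = 0" by (auto simp: algebra_simps)
    define s where "s = t - r"
    have rs: "r + s = t" "r * s = N" using r by (auto simp: s_def algebra_simps)
    have rs0: "r \<noteq> 0" "s \<noteq> 0" using rs tN by auto
    have pair: "x + y = t \<and> x * y = N \<longleftrightarrow> (x = r \<and> y = s) \<or> (x = s \<and> y = r)" for x y
    proof
      assume xy: "x + y = t \<and> x * y = N"
      have "(x - r) * (x - s) = x * x - x * (r + s) + r * s" by (simp add: algebra_simps)
      also have "\<dots> = x * x - x * (x + y) + x * y" using xy rs by simp
      also have "\<dots> = 0" by (simp add: algebra_simps)
      finally have "x = r \<or> x = s" by simp
      moreover have y: "y = t - x" using xy by (auto simp: eq_diff_eq add.commute)
      have "x = r \<Longrightarrow> y = s" "x = s \<Longrightarrow> y = r" unfolding y by (simp_all add: s_def)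
      ultimately show "(x = r \<and> y = s) \<or> (x = s \<and> y = r)" by blast
    qed (use rs in \<open>auto simp: add.commute mult.commute\<close>)
    \<comment> \<open>The map \<open>x ^ q\<close> fixes \<open>t\<close> and \<open>N\<close>,
      hence permutes the two roots of the polynomial.\<close>
    have "r ^ q + s ^ q = t \<and> r ^ q * s ^ q = N"
      using tN rs by (simp add: F_iff flip: q_add power_mult_distrib)
    hence conj: "(r ^ q = r \<and> s ^ q = s) \<or> (r ^ q = s \<and> s ^ q = r)" by (simp only: pair)
    have setA: "{z\<in>A. g z = w} = {z. z \<in> A \<and> (z = r \<and> z ^ q = s \<or> z = s \<and> z ^ q = r)}"
      unfolding pair[symmetric] by (auto simp: g_def w)
    have setB: "{z\<in>B. h z = w} = {(x, y). (x, y) \<in> B \<and> (x = r \<and> y = s \<or> x = s \<and> y = r)}"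
      unfolding pair[symmetric] by (auto simp: h_def w)
    show ?thesis
    proof (cases "r ^ q = r \<and> s ^ q = s")
      case True
      \<comment> \<open>Distinct rational roots give two pairs and no \<open>z\<close>; a double
        root gives one of each.\<close>
      hence "{z\<in>B. h z = w} = {(r, s), (s, r)}"
        unfolding setB using rs0 by (auto simp: B_def F_iff)
      moreover have "{z\<in>A. g z = w} = (if r = s then {r} else {})"
        unfolding setA using True rs0 by (auto simp: A_def E_iff)
      ultimately show ?thesis by simp
    next
      case False
      hence *: "r ^ q = s" "s ^ q = r" "r \<noteq> s" using conj by auto
      hence sB: "{z\<in>B. h z = w} = {}" unfolding setB by (auto simp: B_def F_iff)
      have sA: "{z\<in>A. g z = w} = {r, s}"
        unfolding setA using * rs0 by (auto simp: A_def E_iff)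
      show ?thesis unfolding sA sB using * by simp
    qed
  qed
  have "kloosterman (2 * n) k + (kloosterman n k)\<^sup>2 =
        (\<Sum>w\<in>T. of_nat (card {z\<in>A. g z = w} + card {z\<in>B. h z = w}) * \<phi> w)"
    unfolding 1 2 by (simp add: sum.distrib ring_distribs)
  also have "\<dots> = 2 * (\<Sum>w\<in>T. \<phi> w)" using card2 by (simp add: sum_distrib_left)
  \<comment> \<open>For fixed \<open>N\<close> the trace argument is linear in \<open>t\<close>, so
    orthogonality leaves only \<open>N = -k\<close>.\<close>
  also have "(\<Sum>w\<in>T. \<phi> w) = (\<Sum>N\<in>F-{0}. \<Sum>t\<in>F. \<phi> (t, N))"
    unfolding T_def sum.cartesian_product' by (rule sum.swap)
  also have "\<dots> = (\<Sum>N\<in>F-{0}. if N = -k then of_nat q else 0)"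
  proof (intro sum.cong refl)
    fix N assume N: "N \<in> F - {0}"
    have "(\<Sum>t\<in>F. \<phi> (t, N)) = (\<Sum>t\<in>gf n. addchar (tr n (t * (1 + k / N))))"
      by (simp add: \<phi>_def F_def algebra_simps)
    also have "\<dots> = (if 1 + k / N = 0 then of_nat q else 0)"
      unfolding q_def using N kF by (intro sum_addchar_tr n) (auto simp: F_def intro!: gf_add gf_divide)
    also have "1 + k / N = 0 \<longleftrightarrow> N = -k" using N by (auto simp: field_simps add_eq_0_iff)
    finally show "(\<Sum>t\<in>F. \<phi> (t, N)) = (if N = -k then of_nat q else 0)" .
  qed
  also have "\<dots> = of_nat q"
    using finF k kF by (simp add: F_def gf_uminus)
  finally show ?thesis by (simp add: q_def algebra_simps eq_diff_eq)
qed

section \<open>Stepanov's method for the trace fibres\<close>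

text \<open>
  Bombieri's form of Stepanov's method. For \<open>x\<close> in the field with \<open>Q\<^sup>2\<close> elements put
  \<open>g = tr m (x + k / x)\<close>, so that the trace condition becomes \<open>g ^ Q = c - g\<close>. The \<open>Q\<close>-th power of
  \<open>H x = (\<Sum>(a, b, j). e a b j * x ^ (a + b * Q) * g ^ j)\<close> therefore equals
  \<open>\<Sum>(a, b, j). (e a b j) ^ Q * x ^ (a * Q + b) * (c - g) ^ j\<close> at the points to be counted. The latter
  expression has so small a degree that the coefficients can be chosen to make it vanish
  identically, while \<open>H \<noteq> 0\<close> because its terms have distinct degrees.
\<close>
lemma card_trace_fibre:
  assumes m: "m > 0" and k: "(k :: 'a) \<in> gf 1"
  shows "card {x \<in> gf (2 * m) - {0}. tr (2 * m) (x + k / x) = c} \<le> p ^ (m - 1) * p ^ m + 5 * p ^ m"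
proof -
  define P where "P = p ^ (m - 1)"
  define Q where "Q = p ^ m"
  have P: "P > 0" and QP: "Q = P * p" using p_gt_1 power_minus_mult[OF m, of p] by (simp_all add: P_def Q_def)
  have Q2: "Q \<ge> 2 * P" using QP p_gt_1 by simp
  have Q0: "Q > 0" using P Q2 by simp
  have Pp: "P * (p - 1) = Q - P" using QP by (simp add: algebra_simps)
  have pP: "p ^ i \<le> P" if "i < m" for i
    unfolding P_def using that p_gt_1 by (intro power_increasing) auto
  \<comment> \<open>\<open>P\<close> is the largest exponent in \<open>tr m\<close>, so multiplying
    by \<open>x ^ P\<close> clears all denominators. The term \<open>i = m - 1\<close> makes the
    degree exactly \<open>2 * P\<close>.\<close>
  define G :: "'a poly" where "G = (\<Sum>i<m. monom 1 (P + p ^ i) + monom k (P - p ^ i))"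
  have polyG: "poly G x = x ^ P * tr m (x + k / x)" if "x \<noteq> 0" for x
  proof -
    have "poly G x = (\<Sum>i<m. x ^ P * (x + k / x) ^ (p ^ i))"
      unfolding G_def poly_sum
    proof (intro sum.cong refl)
      fix i assume "i \<in> {..<m}"
      hence "x ^ (P - p ^ i) = x ^ P / x ^ (p ^ i)" using pP that by (simp add: power_diff)
      thus "poly (monom 1 (P + p ^ i) + monom k (P - p ^ i)) x = x ^ P * (x + k / x) ^ (p ^ i)"
        using that gf_1_frob[OF k] by (simp add: poly_monom frob_add power_divide power_add field_simps)
    qed
    thus ?thesis by (simp add: tr_eq sum_distrib_left)
  qed
  have degG_le: "degree G \<le> 2 * P" unfolding G_def
  proof (intro degree_sum_le degree_add_le)
    fix i assume "i \<in> {..<m}"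
    hence "p ^ i \<le> P" using pP by simp
    thus "degree (monom (1 :: 'a) (P + p ^ i)) \<le> 2 * P" "degree (monom k (P - p ^ i)) \<le> 2 * P"
      using degree_monom_le[of "1 :: 'a" "P + p ^ i"] degree_monom_le[of k "P - p ^ i"] by linarith+
  qed auto
  have coeffG: "coeff G (2 * P) = 1"
  proof -
    have "coeff G (2 * P) = (\<Sum>i<m. if i = m - 1 then 1 else 0)"
      unfolding G_def coeff_sum
    proof (intro sum.cong refl)
      fix i assume i: "i \<in> {..<m}"
      have "P - p ^ i \<noteq> 2 * P" using P by linarith
      moreover have "P + p ^ i = 2 * P \<longleftrightarrow> i = m - 1"
        using p_gt_1 by (auto simp: P_def)
      ultimately show "coeff (monom 1 (P + p ^ i) + monom k (P - p ^ i)) (2 * P) =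
          (if i = m - 1 then 1 else 0)" by simp
    qed
    thus ?thesis using m by simp
  qed
  have degG: "degree G = 2 * P" using degG_le le_degree[of G "2 * P"] coeffG by simp
  have G0: "G \<noteq> 0" using coeffG by auto

  \<comment> \<open>The \<open>P + 4\<close> values of \<open>b\<close> make the number of unknowns,
    \<open>P * Q + 4 * Q\<close>, exceed the number \<open>D\<close> of coefficients to be
    killed.\<close>
  define I where "I = {..<P} \<times> {..<P + 4} \<times> {..<p}"
  \<comment> \<open>The last monomial equalises the powers of \<open>x\<close> coming from
    \<open>G ^ j\<close>: for every \<open>j\<close> the total surplus factor is
    \<open>x ^ (Q - P)\<close>. The same holds for \<open>g\<close>.\<close>
  define f where "f = (\<lambda>(a, b, j). monom 1 (a + b * Q) * G ^ j * monom 1 (P * (p - 1 - j)))"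
  define g where "g = (\<lambda>(a, b, j). monom 1 (a * Q + b) * (monom c P - G) ^ j * monom 1 (P * (p - 1 - j)))"
  have finI: "finite I" by (simp add: I_def)
  define D where "D = P * Q + Q + P + 4"
  have "card I = P * Q + 4 * Q" by (simp add: I_def QP algebra_simps)
  hence cardI: "D < card I" using Q2 P unfolding D_def by linarith
  have f_nz: "f i \<noteq> 0" for i using G0 by (cases i) (simp add: f_def monom_eq_0_iff)
  have Pj: "P * (p - 1 - j) + P * j = Q - P" if "j < p" for j
    unfolding Pp[symmetric] distrib_left[symmetric] using that by simp
  have deg_f: "degree (f (a, b, j)) = (a + P * j) + b * Q + (Q - P)" if "j < p" for a b j
  proof -
    have "degree (f (a, b, j)) = (a + b * Q) + j * (2 * P) + P * (p - 1 - j)"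
      using G0 by (simp add: f_def degree_mult_eq monom_eq_0_iff degree_monom_eq degree_power_eq degG)
    moreover have "j * (2 * P) = 2 * (P * j)" by simp
    ultimately show ?thesis using Pj[OF that] by linarith
  qed
  have deg_f_le: "degree (f i) < P * Q + 5 * Q" if "i \<in> I" for i
  proof -
    obtain a b j where i: "i = (a, b, j)" "a < P" "b < P + 4" "j < p" using \<open>i \<in> I\<close> by (auto simp: I_def)
    have "b * Q \<le> (P + 3) * Q" using i by (intro mult_right_mono) auto
    also have "\<dots> = P * Q + 3 * Q" by (rule distrib_right)
    finally show ?thesis using deg_f[OF i(4), of a b] Pj[OF i(4)] i(2) Q2 unfolding i(1) by linarith
  qed
  \<comment> \<open>Since \<open>a < P\<close>, \<open>a + P * j < Q\<close> and
    \<open>Q = P * p\<close>, the degree up to a constant is a mixed-radix number with digits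
    \<open>a\<close>, \<open>j\<close>, \<open>b\<close>.\<close>
  have inj: "inj_on (\<lambda>i. degree (f i)) I"
  proof (rule inj_onI)
    fix i i' assume *: "i \<in> I" "i' \<in> I" "degree (f i) = degree (f i')"
    obtain a b j where i: "i = (a, b, j)" "a < P" "j < p" using *(1) by (auto simp: I_def)
    obtain a' b' j' where i': "i' = (a', b', j')" "a' < P" "j' < p" using *(2) by (auto simp: I_def)
    have lt: "a + P * j < Q" "a' + P * j' < Q"
      using Pj[OF i(3)] Pj[OF i'(3)] i(2) i'(2) Q2 by linarith+
    have eq: "(a + P * j) + b * Q = (a' + P * j') + b' * Q"
      using *(3) deg_f i i' by simp
    hence "((a + P * j) + b * Q) mod Q = ((a' + P * j') + b' * Q) mod Q" by simp
    hence aj: "a + P * j = a' + P * j'" using lt by simp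
    hence "b = b'" using eq Q0 by simp
    have "(a + P * j) mod P = (a' + P * j') mod P" using aj by simp
    hence "a = a'" using i(2) i'(2) by simp
    hence "j = j'" using aj P by simp
    show "i = i'" using i i' \<open>a = a'\<close> \<open>b = b'\<close> \<open>j = j'\<close> by simp
  qed
  have deg_g: "degree (g i) < D" if "i \<in> I" for i
  proof -
    obtain a b j where i: "i = (a, b, j)" "a < P" "b < P + 4" "j < p" using \<open>i \<in> I\<close> by (auto simp: I_def)
    have "degree (monom c P - G) \<le> 2 * P"
      using degree_diff_le[of "monom c P" "2 * P" G] degree_monom_le[of c P] degG by linarith
    hence "degree ((monom c P - G) ^ j) \<le> 2 * P * j"
      by (rule degree_power_le[THEN order_trans, OF mult_right_mono]) auto
    moreover have "degree (g i) \<le> degree (monom (1 :: 'a) (a * Q + b)) + degree ((monom c P - G) ^ j)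
        + degree (monom (1 :: 'a) (P * (p - 1 - j)))"
      unfolding i(1) g_def prod.case
      by (rule order_trans[OF degree_mult_le]) (intro add_mono degree_mult_le order_refl)
    ultimately have "degree (g i) \<le> a * Q + b + 2 * P * j + P * (p - 1 - j)"
      by (simp add: degree_monom_eq)
    moreover have "2 * P * j + P * (p - 1 - j) \<le> 2 * (Q - P)"
      using Pj[OF i(4)] mult.assoc[of 2 P j] by linarith
    ultimately have "degree (g i) \<le> a * Q + b + 2 * (Q - P)" by linarith
    moreover have "a * Q \<le> (P - 1) * Q" using i by (intro mult_right_mono) auto
    moreover have "(P - 1) * Q + Q = P * Q" using P by (cases P) auto
    ultimately show ?thesis unfolding D_def using i(3) Q2 P by linarith
  qed

  obtain d where d: "\<exists>i\<in>I. d i \<noteq> 0" "\<And>n. n < D \<Longrightarrow> (\<Sum>i\<in>I. d i * coeff (g i) n) = 0"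
    using exists_linear_relation[OF finI cardI, of "\<lambda>i. coeff (g i)"] by blast
  have g_sum: "(\<Sum>i\<in>I. smult (d i) (g i)) = 0"
  proof (rule poly_eqI)
    fix n
    show "coeff (\<Sum>i\<in>I. smult (d i) (g i)) n = coeff 0 n"
    proof (cases "n < D")
      case False
      have "coeff (g i) n = 0" if "i \<in> I" for i
        using deg_g[OF that] False by (intro coeff_eq_0) auto
      thus ?thesis by (simp add: coeff_sum)
    qed (simp add: coeff_sum d(2))
  qed
  \<comment> \<open>The relation found is among the coefficients of the \<open>Q\<close>-th power,
    so those of \<open>H\<close> are \<open>Q\<close>-th roots, taken in the algebraically closed
    field.\<close>
  have "\<forall>i. \<exists>y. y ^ Q = d i" using nth_root_exists[OF Q0] by blast
  then obtain e where e: "\<And>i. e i ^ Q = d i" by metis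
  have "\<exists>i\<in>I. e i \<noteq> 0"
  proof -
    obtain i where i: "i \<in> I" "e i ^ Q \<noteq> 0" using d(1) e by auto
    thus ?thesis using Q0 by (intro bexI[of _ i]) auto
  qed
  define H where "H = (\<Sum>i\<in>I. smult (e i) (f i))"
  have H0: "H \<noteq> 0" unfolding H_def
    by (rule sum_smult_distinct_degrees_nonzero[OF finI inj f_nz]) fact
  have degH: "degree H \<le> P * Q + 5 * Q" unfolding H_def
  proof (intro degree_sum_le finI)
    fix i assume "i \<in> I"
    thus "degree (smult (e i) (f i)) \<le> P * Q + 5 * Q"
      using degree_smult_le[of "e i" "f i"] deg_f_le[of i] by linarith
  qed

  have root: "poly H x = 0" if x: "x \<in> gf (2 * m) - {0}" "tr (2 * m) (x + k / x) = c" for x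
  proof -
    define y where "y = tr m (x + k / x)"
    have x0: "x \<noteq> 0" and xQ: "(x ^ Q) ^ Q = x"
      using x(1) by (auto simp: Q_def gf_iff frob_frob mult_2)
    have "y ^ Q = tr m ((x + k / x) ^ Q)"
      unfolding y_def tr_eq Q_def frob_sum by (intro sum.cong refl) (simp add: frob_frob add.commute)
    moreover have "tr (2 * m) (x + k / x) = y + tr m ((x + k / x) ^ Q)"
      unfolding tr_double y_def Q_def by (rule tr_add)
    ultimately have yQ: "y ^ Q = c - y" using x(2) by simp
    \<comment> \<open>The surplus \<open>x ^ (Q - P)\<close> is raised to the power \<open>Q\<close>
      on the \<open>f\<close> side only; the extra factors balance this.\<close>
    have fg: "poly (f i) x ^ Q * x ^ (Q - P) = poly (g i) x * x ^ (Q * (Q - P))" if "i \<in> I" for i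
    proof -
      obtain a b j where i: "i = (a, b, j)" "j < p" using \<open>i \<in> I\<close> by (auto simp: I_def)
      have "poly (f i) x = x ^ (a + b * Q) * (x ^ P * y) ^ j * x ^ (P * (p - 1 - j))"
        by (simp add: i f_def poly_monom polyG[OF x0] y_def)
      also have "\<dots> = x ^ (a + b * Q) * y ^ j * x ^ (P * (p - 1 - j) + P * j)"
        by (simp add: power_mult_distrib power_add power_mult mult_ac)
      finally have 1: "poly (f i) x = x ^ (a + b * Q) * y ^ j * x ^ (Q - P)" unfolding Pj[OF i(2)] .
      have "poly (g i) x = x ^ (a * Q + b) * (c * x ^ P - x ^ P * y) ^ j * x ^ (P * (p - 1 - j))"
        by (simp add: i g_def poly_monom polyG[OF x0] y_def)
      also have "c * x ^ P - x ^ P * y = x ^ P * (c - y)" by (simp add: algebra_simps)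
      also have "x ^ (a * Q + b) * (x ^ P * (c - y)) ^ j * x ^ (P * (p - 1 - j)) =
                 x ^ (a * Q + b) * (c - y) ^ j * x ^ (P * (p - 1 - j) + P * j)"
        by (simp add: power_mult_distrib power_add power_mult mult_ac)
      finally have 2: "poly (g i) x = x ^ (a * Q + b) * (c - y) ^ j * x ^ (Q - P)" unfolding Pj[OF i(2)] .
      have "(x ^ (a + b * Q)) ^ Q = x ^ ((a + b * Q) * Q)" by (simp only: power_mult)
      also have "(a + b * Q) * Q = Q * a + Q * Q * b" by (simp add: algebra_simps)
      also have "x ^ (Q * a + Q * Q * b) = x ^ (Q * a) * ((x ^ Q) ^ Q) ^ b" by (simp only: power_add power_mult)
      also have "\<dots> = x ^ (a * Q + b)" by (simp only: xQ power_add mult.commute)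
      finally have 3: "(x ^ (a + b * Q)) ^ Q = x ^ (a * Q + b)" .
      have 4: "(y ^ j) ^ Q = (c - y) ^ j" unfolding yQ[symmetric] power_mult[symmetric] by (simp only: mult.commute)
      have 5: "(x ^ (Q - P)) ^ Q = x ^ (Q * (Q - P))" by (simp only: mult.commute flip: power_mult)
      show ?thesis unfolding 1 2 power_mult_distrib 3 4 5 by (simp only: mult_ac)
    qed
    have "poly H x ^ Q * x ^ (Q - P) = (\<Sum>i\<in>I. (e i * poly (f i) x) ^ Q) * x ^ (Q - P)"
      unfolding H_def Q_def by (simp add: poly_sum frob_sum)
    also have "\<dots> = (\<Sum>i\<in>I. d i * (poly (f i) x ^ Q * x ^ (Q - P)))"
      by (simp add: power_mult_distrib e sum_distrib_right mult.assoc)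
    also have "\<dots> = (\<Sum>i\<in>I. d i * (poly (g i) x * x ^ (Q * (Q - P))))"
      by (intro sum.cong refl) (simp add: fg)
    also have "\<dots> = poly (\<Sum>i\<in>I. smult (d i) (g i)) x * x ^ (Q * (Q - P))"
      by (simp add: poly_sum sum_distrib_right mult.assoc)
    also have "\<dots> = 0" by (simp add: g_sum)
    finally show ?thesis using x0 by simp
  qed
  have "card {x \<in> gf (2 * m) - {0}. tr (2 * m) (x + k / x) = c} \<le> card {x. poly H x = 0}"
    using root by (intro card_mono poly_roots_finite[OF H0]) auto
  also have "\<dots> \<le> degree H" by (rule card_poly_roots_bound[OF H0])
  also note degH
  finally show ?thesis by (simp add: P_def Q_def)
qed

text \<open>An upper bound \<open>B\<close> for the fibres suffices. As \<open>addchar\<close> sums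
  to zero over the prime field, each fibre size \<open>M c\<close> may be replaced by the deficit
  \<open>B - M c \<ge> 0\<close>, and the deficits add up to
  \<open>p * B - (p ^ (2 * m) - 1)\<close>, where the main terms cancel.\<close>

lemma norm_kloosterman_even:
  assumes m: "m > 0" and k: "(k :: 'a) \<in> gf 1"
  shows "norm (kloosterman (2 * m) k) \<le> 6 * p * p ^ m"
proof -
  define M where "M = (\<lambda>c. card {x \<in> gf (2 * m) - {0 :: 'a}. tr (2 * m) (x + k / x) = c})"
  define B where "B = p ^ (m - 1) * p ^ m + 5 * p ^ m"
  have fin: "finite (gf (2 * m) - {0 :: 'a})" "finite (gf 1 :: 'a set)"
    using card_gf(2)[of "2 * m"] card_gf(2)[of 1] m by auto
  have k': "k \<in> gf (2 * m)" using k by (rule gf_1_subset)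
  have img: "(\<lambda>x. tr (2 * m) (x + k / x)) ` (gf (2 * m) - {0}) \<subseteq> gf 1"
  proof (intro image_subsetI)
    fix x :: 'a assume "x \<in> gf (2 * m) - {0}"
    thus "tr (2 * m) (x + k / x) \<in> gf 1" using k' by (intro tr_in_gf_1 gf_add gf_divide) auto
  qed
  have kloosterman: "kloosterman (2 * m) k = (\<Sum>c\<in>gf 1. of_nat (M c) * addchar c)"
    unfolding kloosterman_def M_def
    using sum.group[OF fin img, of "\<lambda>x. addchar (tr (2 * m) (x + k / x))"] by simp
  have M_le: "M c \<le> B" for c unfolding M_def B_def by (rule card_trace_fibre[OF m k])
  have "(\<Sum>c\<in>gf 1. M c) = card (gf (2 * m) - {0 :: 'a})"
    unfolding M_def using sum.group[OF fin img, of "\<lambda>x. 1 :: nat"] by simp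
  hence sumM: "(\<Sum>c\<in>gf 1. M c) = p ^ (2 * m) - 1" using card_gf[of "2 * m"] m by simp
  have "(\<Sum>c\<in>(gf 1 :: 'a set). addchar c) = 0"
    using sum_addchar_tr[of 1 1] by (simp add: tr_1[simplified])
  hence "kloosterman (2 * m) k = - (\<Sum>c\<in>gf 1. of_nat (B - M c) * addchar c)"
    unfolding kloosterman using M_le by (simp add: of_nat_diff left_diff_distrib sum_subtractf flip: sum_distrib_left)
  also have "norm \<dots> \<le> (\<Sum>c\<in>(gf 1 :: 'a set). norm (of_nat (B - M c) * addchar c))"
    unfolding norm_minus_cancel by (rule norm_sum)
  also have "\<dots> = of_nat (\<Sum>c\<in>(gf 1 :: 'a set). B - M c)"
    by (simp add: norm_mult norm_addchar)
  also have "(\<Sum>c\<in>(gf 1 :: 'a set). B - M c) = p * B - (p ^ (2 * m) - 1)"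
    using sumM M_le card_gf(1)[of 1] by (simp add: sum_subtractf_nat)
  also have "p * B = (p ^ (m - 1) * p) * p ^ m + 5 * p * p ^ m" by (simp add: B_def algebra_simps)
  also have "p ^ (m - 1) * p = p ^ m" by (rule power_minus_mult[OF m])
  also have "p ^ m * p ^ m = p ^ (2 * m)" by (simp add: mult_2 power_add)
  also have "p ^ (2 * m) + 5 * p * p ^ m - (p ^ (2 * m) - 1) \<le> 6 * p * p ^ m"
  proof -
    have "p ^ (2 * m) \<ge> 1" "p * p ^ m \<ge> 1" using p_gt_1 by auto
    thus ?thesis by simp
  qed
  finally show ?thesis by simp
qed

section \<open>Weil's bound over the prime field\<close>

text \<open>The sums over the fields of degree \<open>2 ^ j\<close> are divided by the square root
  of the field size. The bound \<open>6 * p\<close> for them is crude but independent of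
  \<open>j\<close>, so \<open>chebyshev_growth\<close> turns it into the sharp constant 2.\<close>

lemma norm_kloosterman_prime_field:
  assumes k: "(k :: 'a) \<in> gf 1" "k \<noteq> 0"
  shows "norm (kloosterman 1 k) \<le> 2 * sqrt p"
proof -
  define s where "s = (\<lambda>j::nat. norm (kloosterman (2 ^ j) k) / sqrt (p ^ (2 ^ j)))"
  have p0: "real p > 0" using p_gt_1 by simp
  have sqrt_eq: "sqrt (p ^ (2 ^ Suc j)) = p ^ (2 ^ j)" for j
    using p0 by (simp add: power_mult real_sqrt_power mult.commute)
  have "s 0 \<le> 2"
  proof (rule chebyshev_growth)
    fix j :: nat
    define n where "n = (2 :: nat) ^ j"
    have n: "n > 0" by (simp add: n_def)
    have "norm ((kloosterman n k)\<^sup>2) \<le> norm (2 * of_nat (p ^ n) :: complex) + norm (kloosterman (2 * n) k)"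
      unfolding kloosterman_double[OF n k] by (metis norm_triangle_sub norm_minus_commute add.commute)
    hence "norm (kloosterman (2 * n) k) \<ge> (norm (kloosterman n k))\<^sup>2 - 2 * p ^ n"
      by (simp add: norm_power norm_mult)
    hence "norm (kloosterman (2 * n) k) / p ^ n \<ge> ((norm (kloosterman n k))\<^sup>2 - 2 * p ^ n) / p ^ n"
      using p0 by (intro divide_right_mono) auto
    also have "((norm (kloosterman n k))\<^sup>2 - 2 * p ^ n) / p ^ n = (s j)\<^sup>2 - 2"
      using p0 by (simp add: s_def n_def power_divide diff_divide_distrib)
    also have "norm (kloosterman (2 * n) k) / p ^ n = s (Suc j)"
      unfolding s_def sqrt_eq by (simp add: n_def)
    finally show "s (Suc j) \<ge> (s j)\<^sup>2 - 2" .
    have "norm (kloosterman (2 * n) k) \<le> 6 * p * p ^ n" by (rule norm_kloosterman_even[OF n k(1)])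
    thus "s (Suc j) \<le> 6 * p"
      unfolding s_def sqrt_eq using p0 by (simp add: n_def pos_divide_le_eq)
  qed
  thus ?thesis using p0 by (simp add: s_def pos_divide_le_eq)
qed

lemma sum_addchar_nonzero: "(\<Sum>x\<in>gf 1 - {0 :: 'a}. addchar x) = -1"
proof -
  have "(\<Sum>x\<in>(gf 1 :: 'a set). addchar x) = 0"
    using sum_addchar_tr[of 1 1] by (simp add: tr_1[simplified])
  moreover have "(\<Sum>x\<in>(gf 1 :: 'a set). addchar x) = addchar (0 :: 'a) + (\<Sum>x\<in>gf 1 - {0 :: 'a}. addchar x)"
    using card_gf(2)[of 1] by (intro sum.remove) auto
  ultimately show ?thesis by (simp add: addchar_0 eq_neg_iff_add_eq_0 add.commute)
qed

text \<open>Least residues identify the prime field with \<open>{0..<int p}\<close>, and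
  \<open>z\<close> determines \<open>w\<close>. Keeping \<open>F\<close> arbitrary yields both the
  cardinality and the exponential sum.\<close>

lemma sum_hyperbola:
  assumes h: "\<not> int p dvd h"
  shows "(\<Sum>(z, w)\<in>hyperbola p h. F (of_int z :: 'a) (of_int w)) =
         (\<Sum>x\<in>gf 1 - {0}. F x (of_int h / x))"
proof -
  define rep where "rep = inv_into {0..<int p} (of_int :: int \<Rightarrow> 'a)"
  have rep: "rep y \<in> {0..<int p}" "of_int (rep y) = y" if "y \<in> gf 1" for y
    using that unfolding rep_def of_int_image[symmetric]
    by (auto intro: inv_into_into f_inv_into_f simp del: atLeastLessThan_iff)
  have rep_of_int: "rep (of_int z) = z" if "z \<in> {0..<int p}" for z
    unfolding rep_def by (rule inv_into_f_f[OF inj_of_int that])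
  have h0: "(of_int h :: 'a) \<noteq> 0"
    using h of_int_eq_iff_cong[of h 0] by (simp add: cong_0_iff)
  have hyp: "(z, w) \<in> hyperbola p h \<longleftrightarrow> z \<in> {0..<int p} \<and> w \<in> {0..<int p} \<and> of_int z * of_int w = (of_int h :: 'a)" for z w
    unfolding hyperbola_def by (simp flip: of_int_mult add: of_int_eq_iff_cong)
  show ?thesis
  proof (rule sum.reindex_bij_witness[of _ "\<lambda>x. (rep x, rep (of_int h / x))" "\<lambda>(z, w). of_int z"])
    fix v assume "v \<in> hyperbola p h"
    then obtain z w where v: "v = (z, w)" "z \<in> {0..<int p}" "w \<in> {0..<int p}"
      and zw: "of_int z * of_int w = (of_int h :: 'a)" by (cases v) (auto simp: hyp)
    have z0: "(of_int z :: 'a) \<noteq> 0" using zw h0 by auto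
    have w: "of_int h / of_int z = (of_int w :: 'a)" using zw z0 by (simp add: field_simps)
    show "(case v of (z, w) \<Rightarrow> of_int z) \<in> gf 1 - {0 :: 'a}" using z0 of_int_in_gf_1 by (simp add: v)
    show "(rep (case v of (z, w) \<Rightarrow> of_int z), rep (of_int h / (case v of (z, w) \<Rightarrow> of_int z))) = v"
      using v by (simp add: w rep_of_int)
    show "F (case v of (z, w) \<Rightarrow> of_int z) (of_int h / (case v of (z, w) \<Rightarrow> of_int z)) = (case v of (z, w) \<Rightarrow> F (of_int z) (of_int w))"
      by (simp add: v w)
  next
    fix x :: 'a assume x: "x \<in> gf 1 - {0}"
    have hx: "of_int h / x \<in> gf 1" using x of_int_in_gf_1 by (intro gf_divide) auto
    show "(case (rep x, rep (of_int h / x)) of (z, w) \<Rightarrow> of_int z) = x" using x rep by simp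
    show "(rep x, rep (of_int h / x)) \<in> hyperbola p h"
      unfolding hyp using x hx rep by simp
  qed
qed

lemma kloosterman_bound_CHAR: "kloosterman_bound p"
  unfolding kloosterman_bound_def
proof (intro allI impI conjI)
  fix h :: int assume h: "\<not> int p dvd h"
  have p0: "p > 0" using p_gt_1 by simp
  have "card (gf 1 - {0 :: 'a}) = p - 1" using card_gf[of 1] by simp
  thus "card (hyperbola p h) = p - 1"
    using sum_hyperbola[OF h, of "\<lambda>_ _. 1 :: nat"] by (simp add: case_prod_unfold)
  fix a b :: int assume ab: "\<not> (int p dvd a \<and> int p dvd b)"
  define \<alpha> \<beta> \<eta> :: 'a where "\<alpha> = of_int a" and "\<beta> = of_int b" and "\<eta> = of_int h"
  have zero_iff: "(of_int m :: 'a) = 0 \<longleftrightarrow> int p dvd m" for m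
    using of_int_eq_iff_cong[of m 0] by (simp add: cong_0_iff)
  have \<eta>: "\<eta> \<noteq> 0" and \<alpha>\<beta>: "\<alpha> \<noteq> 0 \<or> \<beta> \<noteq> 0" using ab h by (auto simp: \<alpha>_def \<beta>_def \<eta>_def zero_iff)
  have gf: "\<alpha> \<in> gf 1" "\<beta> \<in> gf 1" "\<eta> \<in> gf 1" using of_int_in_gf_1 by (auto simp: \<alpha>_def \<beta>_def \<eta>_def simp del: One_nat_def)
  have "(\<Sum>(z, w)\<in>hyperbola p h. echar p (a * z + b * w)) =
        (\<Sum>(z, w)\<in>hyperbola p h. addchar (\<alpha> * of_int z + \<beta> * of_int w))"
    by (intro sum.cong refl) (auto simp: \<alpha>_def \<beta>_def simp flip: addchar_of_int)
  also have "\<dots> = (\<Sum>x\<in>gf 1 - {0}. addchar (\<alpha> * x + \<beta> * (\<eta> / x)))"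
    unfolding \<eta>_def by (rule sum_hyperbola[OF h, of "\<lambda>z w. addchar (\<alpha> * z + \<beta> * w)"])
  finally have S: "(\<Sum>(z, w)\<in>hyperbola p h. echar p (a * z + b * w)) = \<dots>" .
  have "1 \<le> sqrt p" using p0 by simp
  hence one: "1 \<le> 2 * sqrt p" by linarith
  show "norm (\<Sum>(z, w)\<in>hyperbola p h. echar p (a * z + b * w)) \<le> 2 * sqrt p"
  \<comment> \<open>If exactly one of the two parameters vanishes, the sum runs over all nontrivial
    values of a single character and equals -1. Otherwise scaling \<open>x\<close> by
    \<open>\<alpha>\<close> gives a Kloosterman sum with one parameter.\<close>
  proof (cases "\<alpha> = 0")
    case True
    hence \<beta>: "\<beta> \<noteq> 0" using \<alpha>\<beta> by simp
    have "(\<Sum>x\<in>gf 1 - {0}. addchar (\<alpha> * x + \<beta> * (\<eta> / x))) = (\<Sum>x\<in>gf 1 - {0 :: 'a}. addchar x)"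
      by (rule sum.reindex_bij_witness[of _ "\<lambda>y. \<beta> * \<eta> / y" "\<lambda>x. \<beta> * \<eta> / x"])
         (use True \<beta> \<eta> gf in \<open>auto intro!: gf_divide gf_mult simp del: One_nat_def\<close>)
    thus ?thesis using one by (simp only: S sum_addchar_nonzero) simp
  next
    case False
    have "(\<Sum>x\<in>gf 1 - {0}. addchar (\<alpha> * x + \<beta> * (\<eta> / x))) =
          (\<Sum>x\<in>gf 1 - {0}. addchar (x + \<alpha> * \<beta> * \<eta> / x))"
      by (rule sum.reindex_bij_witness[of _ "\<lambda>y. y / \<alpha>" "\<lambda>x. \<alpha> * x"])
         (use False gf in \<open>auto intro!: gf_divide gf_mult simp del: One_nat_def\<close>)
    also have "\<dots> = kloosterman 1 (\<alpha> * \<beta> * \<eta>)" by (simp add: kloosterman_def tr_1[simplified])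
    finally have S': "(\<Sum>(z, w)\<in>hyperbola p h. echar p (a * z + b * w)) = kloosterman 1 (\<alpha> * \<beta> * \<eta>)" using S by simp
    show ?thesis
    proof (cases "\<beta> = 0")
      case True
      have "kloosterman 1 (\<alpha> * \<beta> * \<eta>) = -1"
        using sum_addchar_nonzero True by (simp add: kloosterman_def tr_1[simplified])
      thus ?thesis using one by (simp add: S')
    next
      case \<beta>: False
      show ?thesis unfolding S'
        by (rule norm_kloosterman_prime_field) (use False \<beta> \<eta> gf in \<open>auto intro!: gf_mult simp del: One_nat_def\<close>)
    qed
  qed
qed

end

section \<open>A field of the required characteristic\<close>

instance alg_closure :: (field_prime_char) field_prime_char
  by standard (use CHAR_alg_closure in \<open>metis of_nat_CHAR CHAR_pos\<close>)

text \<open>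
  A type of prime cardinality cannot depend on a variable \<open>p\<close>. It suffices, however, to have a field
  for one prime that violates the bound if there is any such prime, and such a prime is a closed term.
\<close>
definition critical_prime :: nat where
  "critical_prime = (if \<exists>p. prime p \<and> \<not> kloosterman_bound p
     then SOME p. prime p \<and> \<not> kloosterman_bound p else 2)"

lemma critical_prime:
  shows prime_critical_prime: "prime critical_prime"
    and kloosterman_bound_if_critical:
      "kloosterman_bound critical_prime \<Longrightarrow> prime p \<Longrightarrow> kloosterman_bound p"
  using someI_ex[of "\<lambda>p. prime p \<and> \<not> kloosterman_bound p"]
  by (auto simp: critical_prime_def split: if_splits)

typedef critical_index = "{..<critical_prime}"
  using prime_gt_0_nat[OF prime_critical_prime] by auto

lemma CARD_critical_index: "CARD(critical_index) = critical_prime"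
  using type_definition.card[OF type_definition_critical_index] by simp

text \<open>An infinite type would have cardinality 0, which is not prime.\<close>

instance critical_index :: finite
  by standard (use CARD_critical_index prime_critical_prime in \<open>metis card.infinite not_prime_0\<close>)

instance critical_index :: prime_card
  by standard (simp add: CARD_critical_index prime_critical_prime)

text \<open>The residues indexed by \<open>critical_index\<close> form a field with
  \<open>critical_prime\<close> elements; its algebraic closure is the ambient field for the Weil
  bound.\<close>

lemma kloosterman_bound_prime:
  assumes "prime p"
  shows "kloosterman_bound p"
proof (rule kloosterman_bound_if_critical[OF _ assms])
  have "critical_prime = CHAR(critical_index mod_ring alg_closure)"
    by (simp add: CARD_critical_index)
  thus "kloosterman_bound critical_prime" by (rule kloosterman_bound_CHAR)
qed

section \<open>Points of a modular hyperbola in a box\<close>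

definition expsum :: "nat \<Rightarrow> int set \<Rightarrow> int \<Rightarrow> complex" where
  "expsum p A a = (\<Sum>x\<in>A. echar p (a * x))"

text \<open>A window of length \<open>p\<close> contains each residue once. Length
  \<open>2 * p\<close> is allowed because the interval used in \<open>J4_upper\<close> may be longer
  than \<open>p\<close>.\<close>

lemma card_cong_interval:
  assumes "p > 0" and A: "A \<subseteq> {l..<l + 2 * int p}"
  shows "card {y \<in> A. [x = y] (mod int p)} \<le> 2"
proof -
  have one: "card {y \<in> {m..<m + int p}. [x = y] (mod int p)} \<le> 1" for m
  proof -
    have uniq: "y = z" if "y \<in> {m..<m + int p}" "z \<in> {m..<m + int p}" "[x = y] (mod int p)" "[x = z] (mod int p)" for y z
    proof -
      have "[y - m = z - m] (mod int p)" using that(3,4) by (intro cong_diff) (auto simp: cong_def)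
      thus ?thesis using that(1,2) by (simp add: cong_def)
    qed
    show ?thesis unfolding One_nat_def by (subst card_le_Suc0_iff_eq) (auto intro: uniq simp del: atLeastLessThan_iff)
  qed
  have "{y \<in> A. [x = y] (mod int p)} \<subseteq>
    {y \<in> {l..<l + int p}. [x = y] (mod int p)} \<union> {y \<in> {l + int p..<(l + int p) + int p}. [x = y] (mod int p)}"
    using A by fastforce
  hence "card {y \<in> A. [x = y] (mod int p)} \<le> card ({y \<in> {l..<l + int p}. [x = y] (mod int p)} \<union>
      {y \<in> {l + int p..<(l + int p) + int p}. [x = y] (mod int p)})"
    by (intro card_mono finite_UnI) (auto simp del: atLeastLessThan_iff)
  also have "\<dots> \<le> 1 + 1" by (rule order_trans[OF card_Un_le]) (intro add_mono one)
  finally show ?thesis by simp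
qed

text \<open>Parseval: summing the expanded square over all frequencies keeps only congruent pairs,
  and each \<open>x\<close> has at most 2 partners in \<open>A\<close>.\<close>

lemma sum_norm_expsum_le:
  assumes p: "p > 0" and A: "A \<subseteq> {l..<l + 2 * int p}"
  shows "(\<Sum>a\<in>{0..<int p}. (norm (expsum p A a))\<^sup>2) \<le> 2 * p * card A"
proof -
  have fin: "finite A" using A finite_subset by blast
  have "complex_of_real (\<Sum>a\<in>{0..<int p}. (norm (expsum p A a))\<^sup>2) =
        (\<Sum>a\<in>{0..<int p}. \<Sum>x\<in>A. \<Sum>y\<in>A. echar p (a * (x - y)))"
    unfolding of_real_sum
  proof (intro sum.cong refl)
    fix a
    have "complex_of_real ((norm (expsum p A a))\<^sup>2) = expsum p A a * cnj (expsum p A a)"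
      by (rule complex_norm_square)
    also have "\<dots> = (\<Sum>x\<in>A. \<Sum>y\<in>A. echar p (a * (x - y)))"
      by (simp add: expsum_def sum_product flip: echar_uminus echar_add) (simp add: algebra_simps)
    finally show "complex_of_real ((norm (expsum p A a))\<^sup>2) = \<dots>" .
  qed
  also have "\<dots> = (\<Sum>x\<in>A. \<Sum>a\<in>{0..<int p}. \<Sum>y\<in>A. echar p (a * (x - y)))"
    by (rule sum.swap)
  also have "\<dots> = (\<Sum>x\<in>A. \<Sum>y\<in>A. \<Sum>a\<in>{0..<int p}. echar p (a * (x - y)))"
    by (intro sum.cong refl sum.swap)
  also have "\<dots> = (\<Sum>x\<in>A. \<Sum>y\<in>A. if [x = y] (mod int p) then of_nat p else 0)"
    using p by (simp add: sum_echar cong_iff_dvd_diff)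
  also have "\<dots> = complex_of_real (\<Sum>x\<in>A. real (p * card {y \<in> A. [x = y] (mod int p)}))"
    using fin by (simp add: sum.If_cases Int_def mult.commute)
  finally have "(\<Sum>a\<in>{0..<int p}. (norm (expsum p A a))\<^sup>2) = (\<Sum>x\<in>A. real (p * card {y \<in> A. [x = y] (mod int p)}))"
    by (simp only: of_real_eq_iff)
  also have "\<dots> \<le> (\<Sum>x\<in>A. real (p * 2))"
    using card_cong_interval[OF p A] by (intro sum_mono of_nat_mono mult_left_mono) auto
  also have "\<dots> = 2 * p * card A" by simp
  finally show ?thesis .
qed

text \<open>This splits the condition on a product into two linear congruences, which additive
  characters can detect. Only the pair of least residues can contribute.\<close>

lemma hyperbola_indicator:
  assumes p: "p > 0"
  shows "(\<Sum>(z, w)\<in>hyperbola p h. (if [n = z] (mod int p) then 1 else 0) * (if [m = w] (mod int p) then 1 else 0)) =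
         (if [n * m = h] (mod int p) then 1 else 0 :: complex)"
proof -
  have "(\<Sum>(z, w)\<in>hyperbola p h. (if [n = z] (mod int p) then 1 else 0) * (if [m = w] (mod int p) then 1 else 0)) =
        (\<Sum>v\<in>hyperbola p h. if v = (n mod int p, m mod int p) then 1 else (0 :: complex))"
    by (intro sum.cong refl) (auto simp: hyperbola_def cong_def split: if_splits)
  also have "\<dots> = (if (n mod int p, m mod int p) \<in> hyperbola p h then 1 else 0)" by simp
  also have "(n mod int p, m mod int p) \<in> hyperbola p h \<longleftrightarrow> [n * m = h] (mod int p)"
    using p by (auto simp: hyperbola_def cong_def mod_mult_eq)
  finally show ?thesis .
qed

text \<open>Each of the two linear congruences is detected by a character sum, at the cost of a
  factor \<open>p\<close>. Interchanging the sums collects the points of the hyperbola into a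
  Kloosterman sum.\<close>

lemma count_products_expansion:
  fixes \<phi> :: "'i \<Rightarrow> int"
  assumes p: "p > 0" and fin: "finite I"
  shows "of_nat (p\<^sup>2 * card {(i, j). i \<in> I \<and> j \<in> I \<and> [\<phi> i * \<phi> j = h] (mod int p)}) =
    (\<Sum>a\<in>{0..<int p}. \<Sum>b\<in>{0..<int p}.
       (\<Sum>(z, w)\<in>hyperbola p h. echar p (- a * z + - b * w)) *
       (\<Sum>i\<in>I. echar p (a * \<phi> i)) * (\<Sum>j\<in>I. echar p (b * \<phi> j)))"
proof -
  define R where "R = {0..<int p}"
  define H where "H = hyperbola p h"
  have ind: "(\<Sum>a\<in>R. echar p (a * (n - z))) = of_nat p * (if [n = z] (mod int p) then 1 else 0)" for n z
    using sum_echar[OF p, of "n - z"] by (simp add: cong_iff_dvd_diff R_def)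
  have "of_nat (card {(i, j). i \<in> I \<and> j \<in> I \<and> [\<phi> i * \<phi> j = h] (mod int p)}) =
        (\<Sum>(i, j)\<in>I \<times> I. if [\<phi> i * \<phi> j = h] (mod int p) then 1 else 0 :: complex)"
  proof -
    have "{(i, j). i \<in> I \<and> j \<in> I \<and> [\<phi> i * \<phi> j = h] (mod int p)} =
          (I \<times> I) \<inter> {v. [\<phi> (fst v) * \<phi> (snd v) = h] (mod int p)}" by auto
    thus ?thesis using fin by (simp add: case_prod_unfold sum.If_cases)
  qed
  hence "of_nat (p\<^sup>2 * card {(i, j). i \<in> I \<and> j \<in> I \<and> [\<phi> i * \<phi> j = h] (mod int p)}) =
        (\<Sum>(i, j)\<in>I \<times> I. of_nat (p\<^sup>2) * (if [\<phi> i * \<phi> j = h] (mod int p) then 1 else 0 :: complex))"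
    by (simp add: sum_distrib_left case_prod_unfold)
  also have "\<dots> = (\<Sum>(i, j)\<in>I \<times> I. \<Sum>(z, w)\<in>H.
       (\<Sum>a\<in>R. echar p (a * (\<phi> i - z))) * (\<Sum>b\<in>R. echar p (b * (\<phi> j - w))))"
    unfolding hyperbola_indicator[OF p, symmetric] ind H_def sum_distrib_left
    by (intro sum.cong refl) (auto simp: case_prod_unfold power2_eq_square intro!: sum.cong)
  also have "\<dots> = (\<Sum>v\<in>I \<times> I. \<Sum>u\<in>H. \<Sum>c\<in>R \<times> R.
       echar p (fst c * (\<phi> (fst v) - fst u)) * echar p (snd c * (\<phi> (snd v) - snd u)))"
    by (simp add: case_prod_unfold sum_product sum.cartesian_product)
  also have "\<dots> = (\<Sum>v\<in>I \<times> I. \<Sum>c\<in>R \<times> R. \<Sum>u\<in>H.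
       echar p (fst c * (\<phi> (fst v) - fst u)) * echar p (snd c * (\<phi> (snd v) - snd u)))"
    by (intro sum.cong refl sum.swap)
  also have "\<dots> = (\<Sum>c\<in>R \<times> R. \<Sum>v\<in>I \<times> I. \<Sum>u\<in>H.
       echar p (fst c * (\<phi> (fst v) - fst u)) * echar p (snd c * (\<phi> (snd v) - snd u)))"
    by (rule sum.swap)
  also have "\<dots> = (\<Sum>c\<in>R \<times> R. \<Sum>v\<in>I \<times> I. \<Sum>u\<in>H. echar p (- fst c * fst u + - snd c * snd u) *
       (echar p (fst c * \<phi> (fst v)) * echar p (snd c * \<phi> (snd v))))"
    by (intro sum.cong refl) (simp add: algebra_simps flip: echar_add)
  also have "\<dots> = (\<Sum>c\<in>R \<times> R. (\<Sum>u\<in>H. echar p (- fst c * fst u + - snd c * snd u)) *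
       (\<Sum>v\<in>I \<times> I. echar p (fst c * \<phi> (fst v)) * echar p (snd c * \<phi> (snd v))))"
    by (simp only: sum_distrib_left sum_distrib_right)
  also have "\<dots> = (\<Sum>c\<in>R \<times> R. (\<Sum>u\<in>H. echar p (- fst c * fst u + - snd c * snd u)) *
       ((\<Sum>i\<in>I. echar p (fst c * \<phi> i)) * (\<Sum>j\<in>I. echar p (snd c * \<phi> j))))"
    by (simp add: sum_product sum.cartesian_product case_prod_unfold)
  finally show ?thesis
    by (simp add: R_def H_def sum.cartesian_product case_prod_unfold mult.assoc)
qed

text \<open>Sums \<open>x + u\<close> counted with multiplicity are the convolution of the
  indicators of \<open>A\<close> and \<open>B\<close>, so their Fourier coefficients are products.
  Cauchy-Schwarz and Parseval bound the absolute sum of these by \<open>2 * p * sqrt W\<close>,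
  without a logarithm.\<close>

lemma count_products:
  fixes A B :: "int set"
  assumes p: "prime p" and kb: "kloosterman_bound p" and h: "\<not> int p dvd h"
    and A: "A \<subseteq> {l..<l + 2 * int p}" and B: "B \<subseteq> {l'..<l' + 2 * int p}"
  defines "W \<equiv> real (card A * card B)"
  shows "\<bar>real (card {((x, u), (y, v)). (x, u) \<in> A \<times> B \<and> (y, v) \<in> A \<times> B \<and>
            [(x + u) * (y + v) = h] (mod int p)}) - W\<^sup>2 / p\<bar> \<le> 12 * sqrt p * W"
proof -
  have p0: "p > 0" and p1: "p \<ge> 1" using prime_gt_0_nat[OF p] by auto
  have finA: "finite A" and finB: "finite B" using A B finite_subset by blast+
  define \<phi> where "\<phi> = (\<lambda>i :: int \<times> int. fst i + snd i)"
  define S where "S = (\<lambda>(a, b). \<Sum>(z, w)\<in>hyperbola p h. echar p (- a * z + - b * w))"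
  define f where "f = (\<lambda>a. \<Sum>i\<in>A \<times> B. echar p (a * \<phi> i))"
  define R where "R = {0..<int p}"
  define T where "T = card {(i, j). i \<in> A \<times> B \<and> j \<in> A \<times> B \<and> [\<phi> i * \<phi> j = h] (mod int p)}"
  have T: "T = card {((x, u), (y, v)). (x, u) \<in> A \<times> B \<and> (y, v) \<in> A \<times> B \<and> [(x + u) * (y + v) = h] (mod int p)}"
    unfolding T_def \<phi>_def by (rule arg_cong[of _ _ card]) auto
  have f_eq: "f a = expsum p A a * expsum p B a" for a
    unfolding f_def expsum_def sum_product sum.cartesian_product \<phi>_def
    by (intro sum.cong refl) (auto simp: distrib_left echar_add)
  have cs: "(\<Sum>a\<in>R. norm (f a))\<^sup>2 \<le> 4 * (real p)\<^sup>2 * W"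
  proof -
    have "(\<Sum>a\<in>R. norm (f a))\<^sup>2 = (\<Sum>a\<in>R. norm (expsum p A a) * norm (expsum p B a))\<^sup>2"
      by (simp add: f_eq norm_mult)
    also have "\<dots> \<le> (\<Sum>a\<in>R. (norm (expsum p A a))\<^sup>2) * (\<Sum>a\<in>R. (norm (expsum p B a))\<^sup>2)"
      by (rule Cauchy_Schwarz_ineq_sum)
    also have "\<dots> \<le> real (2 * p * card A) * real (2 * p * card B)"
      unfolding R_def using sum_norm_expsum_le[OF p0 A] sum_norm_expsum_le[OF p0 B]
      by (intro mult_mono) (auto intro: sum_nonneg)
    finally show ?thesis by (simp add: W_def power2_eq_square mult_ac)
  qed
  have fin: "finite (R \<times> R)" and zero: "(0, 0) \<in> R \<times> R" using p0 by (auto simp: R_def)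
  have "of_nat (p\<^sup>2 * T) = (\<Sum>(a, b)\<in>R \<times> R. S (a, b) * f a * f b)"
    unfolding T_def S_def f_def R_def prod.case sum.cartesian_product[symmetric]
    by (rule count_products_expansion[OF p0]) (simp add: finA finB)
  \<comment> \<open>The zero frequency is the main term; at all others the Kloosterman bound
    applies.\<close>
  also have "\<dots> = S (0, 0) * f 0 * f 0 + (\<Sum>(a, b)\<in>R \<times> R - {(0, 0)}. S (a, b) * f a * f b)"
    by (subst sum.remove[OF fin zero]) auto
  also have "S (0, 0) = of_nat (p - 1)"
    using kb h by (simp add: S_def kloosterman_bound_def case_prod_unfold)
  also have "f 0 = of_real W" by (simp add: f_def W_def card_cartesian_product)
  finally have "of_nat (p\<^sup>2 * T) - of_nat (p - 1) * of_real W * of_real W =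
      (\<Sum>(a, b)\<in>R \<times> R - {(0, 0)}. S (a, b) * f a * f b)" by simp
  moreover have "of_nat (p\<^sup>2 * T) - of_nat (p - 1) * of_real W * of_real W =
      complex_of_real (real (p\<^sup>2 * T) - real (p - 1) * W\<^sup>2)" by (simp add: power2_eq_square)
  ultimately have "\<bar>real (p\<^sup>2 * T) - real (p - 1) * W\<^sup>2\<bar> =
      norm (\<Sum>(a, b)\<in>R \<times> R - {(0, 0)}. S (a, b) * f a * f b)" by (metis norm_of_real)
  also have "\<dots> \<le> (\<Sum>c\<in>R \<times> R - {(0, 0)}. 2 * sqrt p * (norm (f (fst c)) * norm (f (snd c))))"
  proof (rule sum_norm_le)
    fix c assume c: "c \<in> R \<times> R - {(0, 0)}"
    obtain a b where ab: "c = (a, b)" by (cases c)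
    have "\<not> (int p dvd - a \<and> int p dvd - b)"
      using c by (auto simp: ab R_def dvd_imp_le_int zdvd_not_zless)
    hence "norm (S (a, b)) \<le> 2 * sqrt p"
      using kb h unfolding S_def kloosterman_bound_def prod.case by blast
    hence "norm (S (a, b)) * (norm (f a) * norm (f b)) \<le> 2 * sqrt p * (norm (f a) * norm (f b))"
      by (intro mult_right_mono) auto
    thus "norm (case c of (a, b) \<Rightarrow> S (a, b) * f a * f b) \<le> 2 * sqrt p * (norm (f (fst c)) * norm (f (snd c)))"
      by (simp add: ab norm_mult mult.assoc)
  qed
  also have "\<dots> \<le> (\<Sum>c\<in>R \<times> R. 2 * sqrt p * (norm (f (fst c)) * norm (f (snd c))))"
    using fin by (intro sum_mono2) auto
  also have "\<dots> = 2 * sqrt p * (\<Sum>a\<in>R. norm (f a))\<^sup>2"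
    unfolding power2_eq_square sum_product sum.cartesian_product
    by (simp add: sum_distrib_left case_prod_unfold)
  also have "\<dots> \<le> 2 * sqrt p * (4 * (real p)\<^sup>2 * W)" by (intro mult_left_mono cs) auto
  finally have 1: "\<bar>real (p\<^sup>2 * T) - real (p - 1) * W\<^sup>2\<bar> \<le> (real p)\<^sup>2 * (8 * sqrt p * W)" by (simp only: mult_ac)
  \<comment> \<open>Replacing \<open>p - 1\<close> by \<open>p\<close> in the main term costs
    \<open>W\<^sup>2 / p\<^sup>2\<close>, at most \<open>4 * sqrt p * W\<close> because
    \<open>W \<le> 4 * p\<^sup>2\<close>. With the 8 obtained above this makes 12.\<close>
  have W0: "W \<ge> 0" by (simp add: W_def)
  have "card A \<le> 2 * p" "card B \<le> 2 * p"
    using card_mono[OF _ A] card_mono[OF _ B] by auto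
  hence "card A * card B \<le> (2 * p) * (2 * p)" by (rule mult_mono) auto
  hence "W \<le> real ((2 * p) * (2 * p))" unfolding W_def by (rule of_nat_mono)
  hence "W * W \<le> (4 * (real p)\<^sup>2) * W" using W0 by (intro mult_right_mono) (auto simp: power2_eq_square)
  moreover have "W * 1 \<le> W * sqrt p" using p1 W0 by (intro mult_left_mono) auto
  hence "(real p)\<^sup>2 * (4 * W) \<le> (real p)\<^sup>2 * (4 * sqrt p * W)" by (intro mult_left_mono) (auto simp: mult_ac)
  ultimately have 2: "W\<^sup>2 \<le> (real p)\<^sup>2 * (4 * sqrt p * W)" by (simp add: power2_eq_square mult_ac)
  have 3: "(real p)\<^sup>2 * (real T - W\<^sup>2 / p) = (real (p\<^sup>2 * T) - real (p - 1) * W\<^sup>2) - W\<^sup>2"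
    using p1 by (simp add: of_nat_diff field_simps power2_eq_square)
  have "\<bar>(real p)\<^sup>2 * (real T - W\<^sup>2 / p)\<bar> \<le> (real p)\<^sup>2 * (12 * sqrt p * W)"
  proof -
    have "\<bar>Y\<bar> \<le> k'" if "Y = Z - x" "\<bar>Z\<bar> \<le> k" "x \<le> k' - k" "0 \<le> x" for Y Z x k k' :: real
      using that by linarith
    moreover have "(real p)\<^sup>2 * (12 * sqrt p * W) - (real p)\<^sup>2 * (8 * sqrt p * W) = (real p)\<^sup>2 * (4 * sqrt p * W)"
      by (simp add: algebra_simps)
    ultimately show ?thesis using 1 2 3 zero_le_power2[of W] by metis
  qed
  hence "(real p)\<^sup>2 * \<bar>real T - W\<^sup>2 / p\<bar> \<le> (real p)\<^sup>2 * (12 * sqrt p * W)" by (simp add: abs_mult)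
  hence "\<bar>real T - W\<^sup>2 / p\<bar> \<le> 12 * sqrt p * W" using p0 by simp
  thus ?thesis by (simp only: T)
qed

section \<open>Bounds from above and below by smoothing\<close>

text \<open>Every \<open>n\<close> in \<open>[1, N]\<close> is \<open>x + u\<close> for each of the
  \<open>M\<close> values of \<open>u\<close> in \<open>B\<close>, with
  \<open>x = n - u \<ge> 2 - M\<close>. So each solution is counted at least \<open>M * M\<close>
  times.\<close>

lemma J4_upper:
  assumes p: "prime p" and kb: "kloosterman_bound p" and h: "\<not> int p dvd h"
    and N: "1 \<le> N" "N < int p" and M: "1 \<le> M" "M \<le> int p"
  shows "real (J4 (int p) N h) \<le> (real_of_int (N + M))\<^sup>2 / p + 12 * sqrt p * real_of_int (N + M) / M"
proof -
  define A where "A = {2 - M..N}"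
  define B where "B = {0..<M}"
  define T where "T = {((x, u), (y, v)). (x, u) \<in> A \<times> B \<and> (y, v) \<in> A \<times> B \<and> [(x + u) * (y + v) = h] (mod int p)}"
  define J where "J = {(x, y). 1 \<le> x \<and> x \<le> N \<and> 1 \<le> y \<and> y \<le> N \<and> [x * y = h] (mod int p)}"
  define W where "W = real (card A * card B)"
  have cards: "real (card A) = real_of_int (N + M - 1)" "real (card B) = real_of_int M"
    using N M by (simp_all add: A_def B_def)
  have p0: "real p > 0" using prime_gt_0_nat[OF p] by simp
  have M0: "real_of_int M > 0" using M N by auto
  have scale: "(a * m)\<^sup>2 / q + c * (b * m) = m * m * (a\<^sup>2 / q + c * b / m)" if "m > 0" for a b c m q :: real
    using that by (simp add: distrib_left power2_eq_square mult_ac)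
  have "finite T"
    by (rule finite_subset[of _ "(A \<times> B) \<times> (A \<times> B)"]) (auto simp: T_def A_def B_def)
  have "card (J \<times> (B \<times> B)) \<le> card T"
  proof (rule card_inj_on_le[OF _ _ \<open>finite T\<close>])
    let ?f = "\<lambda>((n, m), (u, v)). ((n - u, u), (m - v, v)) :: (int \<times> int) \<times> (int \<times> int)"
    show "inj_on ?f (J \<times> (B \<times> B))" by (auto simp: inj_on_def)
    show "?f ` (J \<times> (B \<times> B)) \<subseteq> T" by (auto simp: J_def T_def A_def B_def)
  qed
  hence "real (card (J \<times> (B \<times> B))) \<le> real (card T)" by simp
  hence "real_of_int M * real_of_int M * real (card J) \<le> real (card T)"
    using cards(2) by (simp add: card_cartesian_product mult_ac)
  also have "\<dots> \<le> W\<^sup>2 / p + 12 * sqrt p * W"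
    using count_products[OF p kb h, of A "2 - M" B 0] N M
    unfolding T_def W_def by (force simp: A_def B_def abs_le_iff)
  also have "\<dots> \<le> (real_of_int (N + M) * real_of_int M)\<^sup>2 / p + 12 * sqrt p * (real_of_int (N + M) * real_of_int M)"
  proof -
    have "W = real_of_int (N + M - 1) * real_of_int M" by (simp add: W_def cards)
    also have "\<dots> \<le> real_of_int (N + M) * real_of_int M" using M0 by (intro mult_right_mono) auto
    finally have "W \<le> real_of_int (N + M) * real_of_int M" .
    moreover have "W \<ge> 0" by (simp add: W_def)
    ultimately show ?thesis using p0
      by (intro add_mono divide_right_mono mult_left_mono power_mono) auto
  qed
  also have "\<dots> = real_of_int M * real_of_int M *
      ((real_of_int (N + M))\<^sup>2 / p + 12 * sqrt p * real_of_int (N + M) / M)"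
    by (rule scale[OF M0])
  finally have "real (card J) \<le> (real_of_int (N + M))\<^sup>2 / p + 12 * sqrt p * real_of_int (N + M) / M"
    using M0 by (simp only: mult_le_cancel_left_pos mult_pos_pos)
  thus ?thesis by (simp add: J_def J4_def)
qed

text \<open>With \<open>x \<le> N - M + 1\<close> and \<open>u \<le> M - 1\<close> all sums stay in
  \<open>[1, N]\<close>, and each value arises at most once for every \<open>u\<close>. So each
  solution is counted at most \<open>M * M\<close> times.\<close>

lemma J4_lower:
  assumes p: "prime p" and kb: "kloosterman_bound p" and h: "\<not> int p dvd h"
    and N: "1 \<le> N" "N < int p" and M: "1 \<le> M" "M \<le> N"
  shows "real (J4 (int p) N h) \<ge> (real_of_int (N - M))\<^sup>2 / p - 12 * sqrt p * real_of_int N / M"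
proof -
  define A where "A = {1..N - M + 1}"
  define B where "B = {0..<M}"
  define T where "T = {((x, u), (y, v)). (x, u) \<in> A \<times> B \<and> (y, v) \<in> A \<times> B \<and> [(x + u) * (y + v) = h] (mod int p)}"
  define J where "J = {(x, y). 1 \<le> x \<and> x \<le> N \<and> 1 \<le> y \<and> y \<le> N \<and> [x * y = h] (mod int p)}"
  define W where "W = real (card A * card B)"
  have cards: "real (card A) = real_of_int (N - M + 1)" "real (card B) = real_of_int M"
    using N M by (simp_all add: A_def B_def)
  have p0: "real p > 0" using prime_gt_0_nat[OF p] by simp
  have M0: "real_of_int M > 0" and NM0: "real_of_int (N - M) \<ge> 0" using M N by auto
  have finJ: "finite J"
    by (rule finite_subset[of _ "{1..N} \<times> {1..N}"]) (auto simp: J_def)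
  have "card T \<le> card (J \<times> (B \<times> B))"
  proof (rule card_inj_on_le)
    let ?f = "\<lambda>((x, u), (y, v)). ((x + u, y + v), (u, v)) :: (int \<times> int) \<times> (int \<times> int)"
    show "inj_on ?f T" by (auto simp: inj_on_def)
    show "?f ` T \<subseteq> J \<times> (B \<times> B)" by (auto simp: J_def T_def A_def B_def)
    show "finite (J \<times> (B \<times> B))" using finJ by (simp add: B_def)
  qed
  hence "real (card T) \<le> real (card (J \<times> (B \<times> B)))" by simp
  hence 1: "real (card T) \<le> real_of_int M * real_of_int M * real (card J)"
    using cards(2) by (simp add: card_cartesian_product mult_ac)
  have 2: "W\<^sup>2 / p - 12 * sqrt p * W \<le> real (card T)"
    using count_products[OF p kb h, of A 1 B 0] N M
    unfolding T_def W_def by (force simp: A_def B_def abs_le_iff)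
  have "real_of_int M * real_of_int M * ((real_of_int (N - M))\<^sup>2 / p - 12 * sqrt p * real_of_int N / M) =
        (real_of_int (N - M) * real_of_int M)\<^sup>2 / p - 12 * sqrt p * (real_of_int N * real_of_int M)"
    unfolding right_diff_distrib power2_eq_square using M0 by (simp add: mult_ac)
  also have "\<dots> \<le> W\<^sup>2 / p - 12 * sqrt p * W"
  proof (intro diff_mono divide_right_mono power_mono mult_left_mono)
    have W: "W = real_of_int (N - M + 1) * real_of_int M" by (simp add: W_def cards)
    show "real_of_int (N - M) * real_of_int M \<le> W" unfolding W using M0 by (intro mult_right_mono) auto
    show "W \<le> real_of_int N * real_of_int M" unfolding W using M by (intro mult_right_mono) auto
    show "0 \<le> real_of_int (N - M) * real_of_int M" using NM0 M0 by simp
  qed auto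
  also note 2
  also note 1
  finally have "(real_of_int (N - M))\<^sup>2 / p - 12 * sqrt p * real_of_int N / M \<le> real (card J)"
    using M0 by (simp only: mult_le_cancel_left_pos mult_pos_pos)
  thus ?thesis by (simp add: J_def J4_def)
qed

section \<open>Choice of the smoothing length\<close>

text \<open>With \<open>t = p powr (1/4)\<close>, the length \<open>M\<close> of order
  \<open>t ^ 3\<close> balances the smoothing error \<open>N * M / p\<close> against the Fourier
  error \<open>sqrt p * N / M\<close>: both become \<open>N / t\<close>.\<close>

lemma J4_asymptotic:
  assumes p: "prime p" and kb: "kloosterman_bound p" and h: "\<not> int p dvd h"
    and N: "1 \<le> N" "N < int p"
  shows "\<bar>real (J4 (int p) N h) - (of_int N)\<^sup>2 / p\<bar> \<le> 44 * (of_int N / p powr (1/4) + p powr (1/2))"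
proof -
  define t where "t = real p powr (1/4)"
  have p1: "real p \<ge> 1" using prime_ge_1_nat[OF p] by simp
  have t1: "t \<ge> 1" unfolding t_def using p1 by (intro ge_one_powr_ge_zero) auto
  have t4: "t ^ 4 = p" and t2: "t ^ 2 = sqrt p" using p1
    by (simp_all add: t_def powr_powr powr_half_sqrt flip: powr_realpow)
  have half: "real p powr (1/2) = t\<^sup>2" using p1 by (simp add: t2 powr_half_sqrt)
  define M where "M = \<lceil>t ^ 3\<rceil>"
  have t3: "t ^ 3 \<ge> 1" using t1 by simp
  have M_ge: "t ^ 3 \<le> real_of_int M" and M_le: "real_of_int M \<le> 2 * t ^ 3"
    using t3 unfolding M_def by linarith+
  have M1: "1 \<le> M" using t3 M_ge by linarith
  have "t ^ 3 \<le> t ^ 4" using t1 by (intro power_increasing) auto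
  hence Mp: "M \<le> int p" unfolding M_def t4 by (simp add: ceiling_le_iff)
  define n m J where "n = real_of_int N" and "m = real_of_int M" and "J = real (J4 (int p) N h)"
  have pos: "n > 0" "m > 0" "t > 0" using N M1 t1 by (auto simp: n_def m_def)
  have m: "t ^ 3 \<le> m" "m \<le> 2 * t ^ 3" using M_ge M_le by (auto simp: m_def)
  have up: "J \<le> (n + m)\<^sup>2 / t ^ 4 + 12 * t\<^sup>2 * (n + m) / m"
    using J4_upper[OF p kb h N M1 Mp] by (simp add: J_def n_def m_def t4 t2)
  have div_m: "t\<^sup>2 * x / m \<le> x / t" if "x \<ge> 0" for x
  proof -
    have "t\<^sup>2 * x / m \<le> t\<^sup>2 * x / t ^ 3" using that pos m by (intro divide_left_mono) auto
    also have "\<dots> = x / t" using pos by (simp add: power2_eq_square power3_eq_cube)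
    finally show ?thesis .
  qed
  have mul_m: "x * m / t ^ 4 \<le> 2 * (x / t)" if "x \<ge> 0" for x
  proof -
    have "x * m / t ^ 4 \<le> x * (2 * t ^ 3) / t ^ 4" using that pos m by (intro divide_right_mono mult_left_mono) auto
    also have "\<dots> = 2 * (x / t)" using pos by (simp add: field_simps power_eq_if)
    finally show ?thesis .
  qed
  have nt: "n / t \<ge> 0" and t2': "t\<^sup>2 \<ge> 0" using pos by auto
  have combine: "\<bar>J - Q\<bar> \<le> 44 * (r + s)"
    if "J \<le> U + V" "L - W \<le> J" "U \<le> Q + 6 * r" "V \<le> 24 * r" "Q - 4 * r \<le> L" "W \<le> 12 * r" "0 \<le> r" "0 \<le> s"
    for J Q r s U V L W :: real
    by (rule abs_leI; use that in argo)
  have combine': "\<bar>J - Q\<bar> \<le> 44 * (r + s)"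
    if "J \<le> U + V" "U \<le> 16 * s" "V \<le> 24 * s" "Q \<le> 4 * s" "0 \<le> Q" "0 \<le> J" "0 \<le> r" "0 \<le> s"
    for J Q r s U V :: real
    by (rule abs_leI; use that in argo)
  have "\<bar>J - n\<^sup>2 / t ^ 4\<bar> \<le> 44 * (n / t + t\<^sup>2)"
  proof (cases "M \<le> N")
    case True
    hence mn: "m \<le> n" by (simp add: m_def n_def)
    have low: "J \<ge> (n - m)\<^sup>2 / t ^ 4 - 12 * t\<^sup>2 * n / m"
      using J4_lower[OF p kb h N M1 True] by (simp add: J_def n_def m_def t4 t2)
    have "(n + m)\<^sup>2 / t ^ 4 \<le> (n\<^sup>2 + 3 * n * m) / t ^ 4"
      using mn pos by (intro divide_right_mono) (auto simp: power2_eq_square algebra_simps)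
    also have "\<dots> = n\<^sup>2 / t ^ 4 + 3 * (n * m / t ^ 4)" by (simp add: add_divide_distrib)
    also have "\<dots> \<le> n\<^sup>2 / t ^ 4 + 6 * (n / t)" using mul_m[of n] pos by linarith
    finally have a: "(n + m)\<^sup>2 / t ^ 4 \<le> n\<^sup>2 / t ^ 4 + 6 * (n / t)" .
    have "12 * t\<^sup>2 * (n + m) / m = 12 * (t\<^sup>2 * (n + m) / m)" by simp
    also have "\<dots> \<le> 12 * ((n + m) / t)" using div_m[of "n + m"] pos by linarith
    also have "\<dots> \<le> 12 * ((n + n) / t)" using mn pos by (intro mult_left_mono divide_right_mono) auto
    finally have b: "12 * t\<^sup>2 * (n + m) / m \<le> 24 * (n / t)" by simp
    have "n\<^sup>2 / t ^ 4 - 4 * (n / t) \<le> n\<^sup>2 / t ^ 4 - 2 * (n * m / t ^ 4)" using mul_m[of n] pos by linarith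
    also have "\<dots> = (n\<^sup>2 - 2 * n * m) / t ^ 4" by (simp add: diff_divide_distrib)
    also have "\<dots> \<le> (n - m)\<^sup>2 / t ^ 4" using pos by (intro divide_right_mono) (auto simp: power2_eq_square algebra_simps)
    finally have c: "n\<^sup>2 / t ^ 4 - 4 * (n / t) \<le> (n - m)\<^sup>2 / t ^ 4" .
    have "12 * t\<^sup>2 * n / m = 12 * (t\<^sup>2 * n / m)" by simp
    also have "\<dots> \<le> 12 * (n / t)" using div_m[of n] pos by linarith
    finally have d: "12 * t\<^sup>2 * n / m \<le> 12 * (n / t)" .
    show ?thesis by (rule combine[OF up low a b c d nt t2'])
  next
    \<comment> \<open>For \<open>N < M\<close> no lower bound is required:
      \<open>J \<le> 40 * t\<^sup>2\<close> and
      \<open>n\<^sup>2 / t ^ 4 \<le> 4 * t\<^sup>2\<close>, which together give the constant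
      44.\<close>
    case False
    hence nm: "n \<le> m" by (simp add: m_def n_def)
    have mt: "m / t \<le> 2 * t\<^sup>2"
      using m pos by (simp add: field_simps power2_eq_square power3_eq_cube)
    have "m\<^sup>2 / t ^ 4 = m * m / t ^ 4" by (simp add: power2_eq_square)
    also have "\<dots> \<le> 4 * t\<^sup>2" using mul_m[of m] mt pos by linarith
    finally have a: "m\<^sup>2 / t ^ 4 \<le> 4 * t\<^sup>2" .
    have "n\<^sup>2 / t ^ 4 \<le> m\<^sup>2 / t ^ 4" using nm pos by (intro divide_right_mono power_mono) auto
    hence b: "n\<^sup>2 / t ^ 4 \<le> 4 * t\<^sup>2" using a by linarith
    have "(n + m)\<^sup>2 / t ^ 4 \<le> (m + m)\<^sup>2 / t ^ 4" using nm pos by (intro divide_right_mono power_mono) auto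
    also have "\<dots> = 4 * (m\<^sup>2 / t ^ 4)" by (simp add: power2_eq_square)
    finally have c: "(n + m)\<^sup>2 / t ^ 4 \<le> 16 * t\<^sup>2" using a by linarith
    have "12 * t\<^sup>2 * (n + m) / m \<le> 12 * t\<^sup>2 * (m + m) / m"
      using nm pos by (intro divide_right_mono mult_left_mono) auto
    also have "\<dots> = 24 * t\<^sup>2" using pos by (simp add: field_simps)
    finally have d: "12 * t\<^sup>2 * (n + m) / m \<le> 24 * t\<^sup>2" .
    have e: "n\<^sup>2 / t ^ 4 \<ge> 0" "J \<ge> 0" using pos by (auto simp: J_def)
    show ?thesis by (rule combine'[OF up c d b e nt t2'])
  qed
  thus ?thesis by (simp add: J_def n_def t4 half flip: t_def)
qed

theorem theorem5:
  shows "\<exists>C::real. C > 0 \<and>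
    (\<forall>(p::int) (N::int) (h::int).
       prime p \<longrightarrow> 1 \<le> N \<longrightarrow> N < p \<longrightarrow> \<not> [h = 0] (mod p) \<longrightarrow>
       \<bar>real (J4 p N h) - (of_int N)\<^sup>2 / of_int p\<bar>
         \<le> C * (of_int N / of_int p powr (1/4) + of_int p powr (1/2)))"
proof (intro exI[of _ 44] conjI allI impI)
  fix p N h :: int
  assume *: "prime p" "1 \<le> N" "N < p" "\<not> [h = 0] (mod p)"
  define q where "q = nat p"
  have p: "p = int q" using *(1) prime_gt_0_int[of p] by (simp add: q_def)
  have "prime q" using *(1) by (simp add: p)
  thus "\<bar>real (J4 p N h) - (of_int N)\<^sup>2 / of_int p\<bar> \<le> 44 * (of_int N / of_int p powr (1/4) + of_int p powr (1/2))"
    using J4_asymptotic[OF _ kloosterman_bound_prime, of q h N] * unfolding p by (simp add: cong_0_iff)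
qed simp

end
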